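(* Let $n\geq 3$ and let $A^{(1)},\dots,A^{(n)}$ be finite-dimensional complex vector spaces. A tensor $T\in A^{(1)}\otimes\cdots\otimes A^{(n)}$ has geometric rank $1$ if and only if it has partition rank $1$.
   Context: $T$ is regarded as a multilinear function $T:A^{(1)*}\times\cdots\times A^{(n)*}\to\mathbb{C}$. Its geometric rank is $$\mathrm{GR}(T):=\mathrm{codim}\{(x_1,\dots,x_{n-1})\in A^{(1)*}\times\cdots\times A^{(n-1)*}\mid T(x_1,\dots,x_{n-1},x_n)=0\ \forall x_n\in A^{(n)*}\}.$$ $T$ has partition rank $1$ if there is a partition $\{1,\dots,n\}=I\sqcup J$ into nonempty subsets such that $T=T_1\otimes T_2$ for some nonzero $T_1\in\bigotimes_{i\in I}A^{(i)}$ and $T_2\in\bigotimes_{j\in J}A^{(j)}$; equivalently, $T$ is a product of two non-constant multilinear functions. *)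

theory Defs
  imports "HOL-Analysis.Abstract_Topology" "HOL-Library.Extended_Nat" "HOL-Library.FuncSet"
    Complex_Main
begin

subsection \<open>Tensors\<close>

text \<open>
  The finite-dimensional complex vector spaces \<open>A i\<close> are subspaces of one ambient complex vector
  space of arbitrary dimension. This is no restriction, since any family of vector spaces embeds
  into its direct sum.
\<close>

definition fin_dim_subspace :: "(complex \<Rightarrow> 'a \<Rightarrow> 'a) \<Rightarrow> 'a::ab_group_add set \<Rightarrow> bool" where
  "fin_dim_subspace scale S \<longleftrightarrow>
     module.subspace scale S \<and> (\<exists>B. finite B \<and> B \<subseteq> S \<and> S = module.span scale B)"

text \<open>
  Functionals on \<open>S\<close> are extended by \<open>0\<close> outside \<open>S\<close>, so that each functional has exactly one
  representative and the vector space operations of the dual space are the pointwise ones.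
\<close>

definition dual_space :: "(complex \<Rightarrow> 'a \<Rightarrow> 'a) \<Rightarrow> 'a::ab_group_add set \<Rightarrow> ('a \<Rightarrow> complex) set" where
  "dual_space scale S =
     {\<phi>. (\<forall>a\<in>S. \<forall>b\<in>S. \<phi> (a + b) = \<phi> a + \<phi> b) \<and>
         (\<forall>c. \<forall>a\<in>S. \<phi> (scale c a) = c * \<phi> a) \<and>
         (\<forall>a. a \<notin> S \<longrightarrow> \<phi> a = 0)}"

abbreviation dual_prod ::
  "(complex \<Rightarrow> 'a \<Rightarrow> 'a) \<Rightarrow> (nat \<Rightarrow> 'a::ab_group_add set) \<Rightarrow> nat set \<Rightarrow> (nat \<Rightarrow> 'a \<Rightarrow> complex) set" where
  "dual_prod scale A I \<equiv> PiE I (\<lambda>i. dual_space scale (A i))"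

text \<open>
  The tensor product of the \<open>A i\<close> for \<open>i \<in> I\<close> (\<open>I\<close> finite), as the space of multilinear functions
  on the product of the dual spaces.
\<close>

definition tensors ::
  "(complex \<Rightarrow> 'a \<Rightarrow> 'a) \<Rightarrow> (nat \<Rightarrow> 'a::ab_group_add set) \<Rightarrow> nat set
     \<Rightarrow> ((nat \<Rightarrow> 'a \<Rightarrow> complex) \<Rightarrow> complex) set" where
  "tensors scale A I =
     {T \<in> extensional (dual_prod scale A I).
        \<forall>x \<in> dual_prod scale A I. \<forall>i\<in>I.
          (\<forall>u \<in> dual_space scale (A i). \<forall>v \<in> dual_space scale (A i).
             T (x(i := (\<lambda>a. u a + v a))) = T (x(i := u)) + T (x(i := v))) \<and>
          (\<forall>c. \<forall>u \<in> dual_space scale (A i).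
             T (x(i := (\<lambda>a. c * u a))) = c * T (x(i := u)))}"

definition zero_tensor ::
  "(complex \<Rightarrow> 'a \<Rightarrow> 'a) \<Rightarrow> (nat \<Rightarrow> 'a::ab_group_add set) \<Rightarrow> nat set
     \<Rightarrow> ((nat \<Rightarrow> 'a \<Rightarrow> complex) \<Rightarrow> complex)" where
  "zero_tensor scale A I = (\<lambda>x \<in> dual_prod scale A I. 0)"

definition tensor_mult ::
  "(complex \<Rightarrow> 'a \<Rightarrow> 'a) \<Rightarrow> (nat \<Rightarrow> 'a::ab_group_add set) \<Rightarrow> nat set \<Rightarrow> nat set
     \<Rightarrow> ((nat \<Rightarrow> 'a \<Rightarrow> complex) \<Rightarrow> complex) \<Rightarrow> ((nat \<Rightarrow> 'a \<Rightarrow> complex) \<Rightarrow> complex)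
     \<Rightarrow> ((nat \<Rightarrow> 'a \<Rightarrow> complex) \<Rightarrow> complex)" where
  "tensor_mult scale A I J T1 T2 =
     (\<lambda>x \<in> dual_prod scale A (I \<union> J). T1 (restrict x I) * T2 (restrict x J))"

definition partition_rank_one ::
  "(complex \<Rightarrow> 'a \<Rightarrow> 'a) \<Rightarrow> (nat \<Rightarrow> 'a::ab_group_add set) \<Rightarrow> nat
     \<Rightarrow> ((nat \<Rightarrow> 'a \<Rightarrow> complex) \<Rightarrow> complex) \<Rightarrow> bool" where
  "partition_rank_one scale A n T \<longleftrightarrow>
     (\<exists>I J T1 T2. I \<union> J = {1..n} \<and> I \<inter> J = {} \<and> I \<noteq> {} \<and> J \<noteq> {} \<and>
        T1 \<in> tensors scale A I \<and> T1 \<noteq> zero_tensor scale A I \<and>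
        T2 \<in> tensors scale A J \<and> T2 \<noteq> zero_tensor scale A J \<and>
        T = tensor_mult scale A I J T1 T2)"


subsection \<open>Codimension in a topological space\<close>

definition irreducible_closedin :: "'b topology \<Rightarrow> 'b set \<Rightarrow> bool" where
  "irreducible_closedin X Z \<longleftrightarrow> closedin X Z \<and> Z \<noteq> {} \<and>
     (\<forall>F G. closedin X F \<and> closedin X G \<and> Z = F \<union> G \<longrightarrow> Z = F \<or> Z = G)"

text \<open>
  The usual definition of codimension in algebraic geometry (Hartshorne, Section II.3; EGA 0.14.2):
  for an irreducible closed set \<open>Z\<close> it is the supremum of the lengths of the chains
  \<open>Z = C 0 \<subset> C 1 \<subset> \<dots> \<subset> C k\<close> of irreducible closed sets, and for general \<open>Y\<close> it is the infimum
  over the irreducible closed subsets of \<open>Y\<close>. For a nonempty closed subset of an affine space with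
  the Zariski topology this is the difference of the dimensions.
\<close>

definition irreducible_codim :: "'b topology \<Rightarrow> 'b set \<Rightarrow> enat" where
  "irreducible_codim X Z =
     Sup {enat k | k. \<exists>C :: nat \<Rightarrow> 'b set. C 0 = Z \<and>
            (\<forall>i\<le>k. irreducible_closedin X (C i)) \<and> (\<forall>i<k. C i \<subset> C (Suc i))}"

definition codim :: "'b topology \<Rightarrow> 'b set \<Rightarrow> enat" where
  "codim X Y = Inf {irreducible_codim X Z | Z. irreducible_closedin X Z \<and> Z \<subseteq> Y}"


subsection \<open>The Zariski topology and geometric rank\<close>

text \<open>
  The linear functionals on the dual of \<open>A i\<close> are the evaluations at the elements of \<open>A i\<close>, so
  evaluations generate the algebra of polynomial functions on the product of the dual spaces.
\<close>

inductive polynomial_fun ::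
  "(nat \<Rightarrow> 'a set) \<Rightarrow> nat set \<Rightarrow> ((nat \<Rightarrow> 'a \<Rightarrow> complex) \<Rightarrow> complex) \<Rightarrow> bool"
  for A :: "nat \<Rightarrow> 'a set" and I :: "nat set" where
  const: "polynomial_fun A I (\<lambda>x. c)"
| coord: "i \<in> I \<Longrightarrow> a \<in> A i \<Longrightarrow> polynomial_fun A I (\<lambda>x. x i a)"
| add: "polynomial_fun A I f \<Longrightarrow> polynomial_fun A I g \<Longrightarrow> polynomial_fun A I (\<lambda>x. f x + g x)"
| mult: "polynomial_fun A I f \<Longrightarrow> polynomial_fun A I g \<Longrightarrow> polynomial_fun A I (\<lambda>x. f x * g x)"

definition zariski ::
  "(complex \<Rightarrow> 'a \<Rightarrow> 'a) \<Rightarrow> (nat \<Rightarrow> 'a::ab_group_add set) \<Rightarrow> nat set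
     \<Rightarrow> (nat \<Rightarrow> 'a \<Rightarrow> complex) topology" where
  "zariski scale A I =
     topology (\<lambda>U. \<exists>F \<subseteq> Collect (polynomial_fun A I).
       U = {x \<in> dual_prod scale A I. \<exists>f\<in>F. f x \<noteq> 0})"

lemma openin_zariski:
  "openin (zariski scale A I) U \<longleftrightarrow>
     (\<exists>F \<subseteq> Collect (polynomial_fun A I). U = {x \<in> dual_prod scale A I. \<exists>f\<in>F. f x \<noteq> 0})"
proof -
  let ?D = "\<lambda>F. {x \<in> dual_prod scale A I. \<exists>f\<in>F. f x \<noteq> 0}"
  let ?P = "Collect (polynomial_fun A I)"
  have "istopology (\<lambda>U. \<exists>F\<subseteq>?P. U = ?D F)"
    unfolding istopology_def
  proof (intro conjI allI impI)
    fix S T assume "\<exists>F\<subseteq>?P. S = ?D F" "\<exists>F\<subseteq>?P. T = ?D F"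
    then obtain F G where FG: "F \<subseteq> ?P" "S = ?D F" "G \<subseteq> ?P" "T = ?D G"
      by (elim exE conjE)
    let ?H = "{(\<lambda>x. f x * g x) | f g. f \<in> F \<and> g \<in> G}"
    have "?H \<subseteq> ?P"
      using FG by (auto intro: polynomial_fun.mult)
    moreover have "?D F \<inter> ?D G = ?D ?H"
      by fastforce
    ultimately show "\<exists>F\<subseteq>?P. S \<inter> T = ?D F"
      unfolding FG(2,4) by (intro exI conjI)
  next
    fix K assume "\<forall>S\<in>K. \<exists>F\<subseteq>?P. S = ?D F"
    then have "\<exists>F. \<forall>S\<in>K. F S \<subseteq> ?P \<and> S = ?D (F S)"
      by (rule bchoice)
    then obtain F where "\<forall>S\<in>K. F S \<subseteq> ?P \<and> S = ?D (F S)" ..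
    then have F: "S \<in> K \<Longrightarrow> F S \<subseteq> ?P \<and> S = ?D (F S)" for S
      by (rule bspec)
    have "\<Union>K = (\<Union>S\<in>K. S)"
      by simp
    also have "\<dots> = (\<Union>S\<in>K. ?D (F S))"
      by (intro SUP_cong refl) (rule conjunct2[OF F])
    also have "\<dots> = ?D (\<Union>S\<in>K. F S)"
      by blast
    finally have "\<Union>K = ?D (\<Union>S\<in>K. F S)" .
    moreover have "(\<Union>S\<in>K. F S) \<subseteq> ?P"
      by (intro UN_least) (rule conjunct1[OF F])
    ultimately show "\<exists>F\<subseteq>?P. \<Union>K = ?D F"
      by (intro exI conjI)
  qed
  then show ?thesis
    unfolding zariski_def by (simp add: topology_inverse')
qed

lemma topspace_zariski: "topspace (zariski scale A I) = dual_prod scale A I"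
proof
  show "topspace (zariski scale A I) \<subseteq> dual_prod scale A I"
    unfolding topspace_def by (auto simp: openin_zariski)
  have "openin (zariski scale A I) (dual_prod scale A I)"
    unfolding openin_zariski
    by (rule exI[of _ "{\<lambda>x. 1}"]) (auto intro: polynomial_fun.const)
  then show "dual_prod scale A I \<subseteq> topspace (zariski scale A I)"
    by (rule openin_subset)
qed

lemma closedin_zariski:
  "closedin (zariski scale A I) Z \<longleftrightarrow>
     (\<exists>F \<subseteq> Collect (polynomial_fun A I). Z = {x \<in> dual_prod scale A I. \<forall>f\<in>F. f x = 0})"
proof -
  let ?V = "dual_prod scale A I"
  have "closedin (zariski scale A I) Z \<longleftrightarrow>
      (\<exists>F \<subseteq> Collect (polynomial_fun A I). Z \<subseteq> ?V \<and> ?V - Z = {x \<in> ?V. \<exists>f\<in>F. f x \<noteq> 0})"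
    unfolding closedin_def topspace_zariski openin_zariski by blast
  moreover have "(Z \<subseteq> ?V \<and> ?V - Z = {x \<in> ?V. \<exists>f\<in>F. f x \<noteq> 0}) \<longleftrightarrow>
      Z = {x \<in> ?V. \<forall>f\<in>F. f x = 0}"
    for F :: "((nat \<Rightarrow> 'a \<Rightarrow> complex) \<Rightarrow> complex) set"
    by blast
  ultimately show ?thesis
    by (simp only:)
qed

definition geometric_rank ::
  "(complex \<Rightarrow> 'a \<Rightarrow> 'a) \<Rightarrow> (nat \<Rightarrow> 'a::ab_group_add set) \<Rightarrow> nat
     \<Rightarrow> ((nat \<Rightarrow> 'a \<Rightarrow> complex) \<Rightarrow> complex) \<Rightarrow> enat" where
  "geometric_rank scale A n T =
     codim (zariski scale A {1..<n})
       {x \<in> dual_prod scale A {1..<n}. \<forall>y \<in> dual_space scale (A n). T (x(n := y)) = 0}"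

end

(* Where a contraction a(x) = P(x(i := e)) of a multilinear form P is nonzero, the hypersurface P = 0
   is the graph of a rational function. The closure of this graph is therefore irreducible, and
   pseudo-division by P shows that no irreducible closed set lies strictly between it and the whole
   space. This gives codimension 1 for a product of multilinear forms.
   Conversely, let Z be an irreducible closed set of codimension 1 on which all slices Q = T(_, y)
   vanish, and let P be a nonzero multilinear form, in as few blocks as possible, that vanishes on Z.
   No nonzero contraction of P vanishes on Z, so Z is the closure of every graph attached to P, and
   vanishing of Q on such a graph says that Q/P does not depend on the block i. Hence Q = P * R with R
   independent of the blocks of P, where P is the same for all y. No unique factorization of
   polynomials is needed. *)
theory Submission
  imports Defs "HOL-Computational_Algebra.Polynomial"
begin

section \<open>Product of the dual spaces over the blocks \<open>J\<close>, and dual bases\<close>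

locale dual_product = vector_space scale
  for scale :: "complex \<Rightarrow> 'a::ab_group_add \<Rightarrow> 'a" +
  fixes A :: "nat \<Rightarrow> 'a set" and J :: "nat set"
  assumes finite_J: "finite J"
    and fin_dim: "i \<in> J \<Longrightarrow> fin_dim_subspace scale (A i)"
begin

text \<open>Thin the finite spanning set to a basis and take its coordinate functionals, extended by
  0 outside \<open>S\<close>. The coefficient of \<open>\<delta> b\<close> in \<open>u\<close> is
  the evaluation of \<open>u\<close> at \<open>b \<in> S\<close>, hence one of the generators of
  \<open>polynomial_fun\<close>; this is how multilinear functions are later seen to be
  polynomial.\<close>

lemma dual_basis:
  assumes "fin_dim_subspace scale S"
  obtains B \<delta> where "finite B" "B \<subseteq> S" "\<And>b. b \<in> B \<Longrightarrow> \<delta> b \<in> dual_space scale S"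
    "\<And>u. u \<in> dual_space scale S \<Longrightarrow> u = (\<lambda>a. \<Sum>b\<in>B. u b * \<delta> b a)"
proof -
  obtain B0 where S: "subspace S" and B0: "finite B0" "B0 \<subseteq> S" "S = span B0"
    using assms unfolding fin_dim_subspace_def by blast
  obtain B where B: "B \<subseteq> B0" "independent B" "B0 \<subseteq> span B"
    using maximal_independent_subset by blast
  have sB: "S = span B"
    using B B0 S by (metis span_eq span_superset order_trans)
  have finB: "finite B" and BS: "B \<subseteq> S"
    using B B0 finite_subset by blast+
  define \<delta> where "\<delta> b a = (if a \<in> S then representation B a b else 0)" for b a
  have "\<delta> b \<in> dual_space scale S" for b
    unfolding dual_space_def \<delta>_def using B(2)
    by (auto simp: sB representation_add representation_scale span_add span_scale)
  moreover have "u = (\<lambda>a. \<Sum>b\<in>B. u b * \<delta> b a)" if u: "u \<in> dual_space scale S" for u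
  proof
    fix a
    have lin: "u (\<Sum>b\<in>F. scale (c b) b) = (\<Sum>b\<in>F. c b * u b)" if "finite F" "F \<subseteq> B" for F c
      using that
    proof induction
      case empty
      have "u (scale 0 0) = 0 * u 0"
        using u subspace_0[OF S] unfolding dual_space_def by blast
      then show ?case by simp
    next
      case (insert b F)
      have "scale (c b) b \<in> S" "(\<Sum>b\<in>F. scale (c b) b) \<in> S" "b \<in> S"
        using insert BS S by (auto intro!: subspace_scale subspace_sum)
      then show ?case
        using insert u unfolding dual_space_def by auto
    qed
    show "u a = (\<Sum>b\<in>B. u b * \<delta> b a)"
    proof (cases "a \<in> S")
      case True
      have "a = (\<Sum>b\<in>B. scale (representation B a b) b)"
        using sum_representation_eq[OF B(2) _ finB order_refl] True sB by simp
      then have "u a = u (\<Sum>b\<in>B. scale (representation B a b) b)" by simp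
      also have "\<dots> = (\<Sum>b\<in>B. representation B a b * u b)"
        by (rule lin[OF finB order_refl])
      finally show ?thesis
        using True by (simp add: \<delta>_def mult.commute)
    qed (use u in \<open>simp add: dual_space_def \<delta>_def\<close>)
  qed
  ultimately show ?thesis
    using that finB BS by blast
qed

abbreviation "D i \<equiv> dual_space scale (A i)"
abbreviation "V \<equiv> dual_prod scale A J"
abbreviation "X \<equiv> zariski scale A J"

lemma dual_zero: "(\<lambda>a. 0) \<in> D i"
  by (simp add: dual_space_def)

lemma dual_add: "u \<in> D i \<Longrightarrow> v \<in> D i \<Longrightarrow> (\<lambda>a. u a + v a) \<in> D i"
  by (auto simp: dual_space_def algebra_simps)

lemma dual_scale: "u \<in> D i \<Longrightarrow> (\<lambda>a. c * u a) \<in> D i"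
  by (auto simp: dual_space_def algebra_simps)

lemma dual_axpy: "u \<in> D i \<Longrightarrow> v \<in> D i \<Longrightarrow> (\<lambda>a. u a + c * v a) \<in> D i"
  by (intro dual_add dual_scale)

lemma V_update: "x \<in> V \<Longrightarrow> i \<in> J \<Longrightarrow> u \<in> D i \<Longrightarrow> x(i := u) \<in> V"
  by (auto simp: PiE_iff extensional_def)

lemma V_mem: "x \<in> V \<Longrightarrow> i \<in> J \<Longrightarrow> x i \<in> D i"
  by auto

lemma V_override: "x \<in> V \<Longrightarrow> z \<in> V \<Longrightarrow> override_on x z S \<in> V"
  by (auto simp: PiE_iff extensional_def override_on_def)


subsection \<open>Polynomial functions and irreducible closed sets\<close>

text \<open>Functions are compared on \<open>V\<close> only, because tensors and multilinear
  functions are controlled only there; \<open>pol\<close> is thus stable under changes outside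
  \<open>V\<close>.\<close>

definition pol :: "((nat \<Rightarrow> 'a \<Rightarrow> complex) \<Rightarrow> complex) \<Rightarrow> bool" where
  "pol f \<longleftrightarrow> (\<exists>g. polynomial_fun A J g \<and> (\<forall>x\<in>V. f x = g x))"

lemma pol_cong: "pol f \<Longrightarrow> (\<And>x. x \<in> V \<Longrightarrow> f x = g x) \<Longrightarrow> pol g"
  unfolding pol_def by (metis (no_types, lifting))

lemma pol_const: "pol (\<lambda>x. c)"
  unfolding pol_def by (blast intro: polynomial_fun.const)

lemma pol_coord: "i \<in> J \<Longrightarrow> a \<in> A i \<Longrightarrow> pol (\<lambda>x. x i a)"
  unfolding pol_def by (blast intro: polynomial_fun.coord)

lemma pol_add: "pol f \<Longrightarrow> pol g \<Longrightarrow> pol (\<lambda>x. f x + g x)"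
  unfolding pol_def by (metis (no_types, lifting) polynomial_fun.add)

lemma pol_mult: "pol f \<Longrightarrow> pol g \<Longrightarrow> pol (\<lambda>x. f x * g x)"
  unfolding pol_def by (metis (no_types, lifting) polynomial_fun.mult)

lemma pol_diff: "pol f \<Longrightarrow> pol g \<Longrightarrow> pol (\<lambda>x. f x - g x)"
  using pol_add[of f "\<lambda>x. (-1) * g x"] pol_mult[OF pol_const[of "-1"], of g] by simp

lemma pol_power: "pol f \<Longrightarrow> pol (\<lambda>x. f x ^ d)"
  by (induction d) (simp_all add: pol_const pol_mult)

lemma pol_sum: "finite B \<Longrightarrow> (\<And>b. b \<in> B \<Longrightarrow> pol (f b)) \<Longrightarrow> pol (\<lambda>x. \<Sum>b\<in>B. f b x)"
  by (induction rule: finite_induct) (simp_all add: pol_const pol_add)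

text \<open>This is irreducibility of the affine space \<open>V\<close>. On the line through
  \<open>z\<close> and \<open>x\<close> both functions become univariate polynomials over an
  infinite field, and such polynomials have no zero divisors.\<close>

lemma pol_vanish:
  assumes "pol f" "pol g" "\<And>x. x \<in> V \<Longrightarrow> f x * g x = 0" "z \<in> V" "f z \<noteq> 0" "x \<in> V"
  shows "g x = 0"
proof (rule ccontr)
  assume gx: "g x \<noteq> 0"
  \<comment> \<open>The line \<open>z + s * (x - z)\<close>, with \<open>l 0 = z\<close> and
    \<open>l 1 = x\<close>; the restriction to \<open>J\<close> keeps its points
    extensional.\<close>
  define l where "l s = (\<lambda>j\<in>J. \<lambda>a. z j a + s * (x j a - z j a))" for s :: complex
  have lV: "l s \<in> V" for s
  proof -
    have "(\<lambda>a. z j a + s * (x j a + (-1) * z j a)) \<in> D j" if "j \<in> J" for j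
      using that assms(4,6) by (intro dual_axpy) auto
    then show ?thesis by (auto simp: l_def)
  qed
  have poly: "\<exists>p. \<forall>s. h (l s) = poly p s" if h: "pol h" for h
  proof -
    obtain k where k: "polynomial_fun A J k" "\<And>x. x \<in> V \<Longrightarrow> h x = k x"
      using h unfolding pol_def by blast
    from k(1) have "\<exists>p. \<forall>s. k (l s) = poly p s"
    proof induction
      case (const c)
      then show ?case by (intro exI[of _ "[:c:]"]) simp
    next
      case (coord j a)
      then show ?case
        by (intro exI[of _ "[:z j a, x j a - z j a:]"]) (simp add: l_def)
    next
      case (add f g)
      then show ?case by (metis poly_add)
    next
      case (mult f g)
      then show ?case by (metis poly_mult)
    qed
    then show ?thesis using k(2) lV by simp
  qed
  obtain p q where p: "\<And>s. f (l s) = poly p s" and q: "\<And>s. g (l s) = poly q s"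
    using poly assms(1,2) by metis
  have "l 0 = z" "l 1 = x"
    using assms(4,6) by (auto simp: l_def fun_eq_iff PiE_iff extensional_def)
  then have "p * q \<noteq> 0"
    using p[of 0] q[of 1] gx assms(5) by auto
  moreover have "\<forall>s. poly (p * q) s = 0"
    using assms(3)[OF lV] p q by simp
  ultimately show False
    using poly_all_0_iff_0 by blast
qed

lemma closedin_pol:
  "closedin X Z \<longleftrightarrow> (\<exists>F \<subseteq> Collect pol. Z = {x \<in> V. \<forall>f\<in>F. f x = 0})"
proof
  assume "closedin X Z"
  then show "\<exists>F \<subseteq> Collect pol. Z = {x \<in> V. \<forall>f\<in>F. f x = 0}"
    unfolding closedin_zariski
  proof (elim exE conjE)
    fix F assume "F \<subseteq> Collect (polynomial_fun A J)" "Z = {x \<in> V. \<forall>f\<in>F. f x = 0}"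
    moreover from this have "F \<subseteq> Collect pol" unfolding pol_def by blast
    ultimately show ?thesis by (intro exI conjI)
  qed
next
  assume "\<exists>F \<subseteq> Collect pol. Z = {x \<in> V. \<forall>f\<in>F. f x = 0}"
  then obtain F where F: "F \<subseteq> Collect pol" "Z = {x \<in> V. \<forall>f\<in>F. f x = 0}" by blast
  \<comment> \<open>\<open>F\<close> consists of functions known only up to their values on
    \<open>V\<close>; \<open>H\<close> collects all genuine polynomials that represent them.\<close>
  define H where "H = {g. polynomial_fun A J g \<and> (\<exists>f\<in>F. \<forall>x\<in>V. f x = g x)}"
  have "Z = {x \<in> V. \<forall>g\<in>H. g x = 0}"
  proof (intro equalityI subsetI)
    fix x assume x: "x \<in> {x \<in> V. \<forall>g\<in>H. g x = 0}"
    have "f x = 0" if f: "f \<in> F" for f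
    proof -
      obtain g where g: "polynomial_fun A J g" "\<forall>x\<in>V. f x = g x"
        using F(1) f unfolding pol_def by blast
      then have "g \<in> H" unfolding H_def using f by blast
      then show ?thesis using x g by auto
    qed
    then show "x \<in> Z" using x F(2) by blast
  qed (use F(2) in \<open>auto simp: H_def\<close>)
  moreover have "H \<subseteq> Collect (polynomial_fun A J)" by (auto simp: H_def)
  ultimately show "closedin X Z" unfolding closedin_zariski by blast
qed

lemma closedin_subset_V: "closedin X Z \<Longrightarrow> Z \<subseteq> V"
  using closedin_subset topspace_zariski by metis

lemma closedin_separate:
  assumes "closedin X H" "x \<in> V" "x \<notin> H"
  obtains f where "pol f" "\<And>y. y \<in> H \<Longrightarrow> f y = 0" "f x \<noteq> 0"
proof -
  obtain E where E: "E \<subseteq> Collect pol" "H = {x \<in> V. \<forall>f\<in>E. f x = 0}"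
    by (rule closedin_pol[THEN iffD1, OF assms(1), THEN exE]) (elim conjE, rule that)
  then obtain f where "f \<in> E" "f x \<noteq> 0"
    using assms(2,3) by blast
  moreover have "f y = 0" if "y \<in> H" for y
    using that E(2) \<open>f \<in> E\<close> by blast
  ultimately show ?thesis using E(1) that by blast
qed

text \<open>The algebraic form of irreducibility: the vanishing ideal of \<open>Z\<close> is prime.
  One direction cuts \<open>Z\<close> by the zero sets of \<open>f\<close> and \<open>g\<close>; in
  the other, polynomials vanishing on \<open>F\<close> and on \<open>G\<close> but not on
  \<open>Z\<close> have a product that vanishes on \<open>Z\<close>.\<close>

lemma irreducible_iff:
  assumes "closedin X Z"
  shows "irreducible_closedin X Z \<longleftrightarrow> Z \<noteq> {} \<and>
    (\<forall>f g. pol f \<and> pol g \<and> (\<forall>x\<in>Z. f x * g x = 0) \<longrightarrow> (\<forall>x\<in>Z. f x = 0) \<or> (\<forall>x\<in>Z. g x = 0))"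
    (is "_ \<longleftrightarrow> _ \<and> ?R")
proof -
  have R: "?R" if irr: "irreducible_closedin X Z"
  proof (intro allI impI, elim conjE)
    fix f g assume f: "pol f" and g: "pol g" and fg: "\<forall>x\<in>Z. f x * g x = 0"
    have cl: "closedin X (Z \<inter> {x \<in> V. h x = 0})" if "pol h" for h
    proof (rule closedin_Int[OF assms])
      show "closedin X {x \<in> V. h x = 0}"
        unfolding closedin_pol using that by (intro exI[of _ "{h}"]) auto
    qed
    have eq: "Z = (Z \<inter> {x \<in> V. f x = 0}) \<union> (Z \<inter> {x \<in> V. g x = 0})"
      using fg closedin_subset_V[OF assms] by auto
    have "Z = Z \<inter> {x \<in> V. f x = 0} \<or> Z = Z \<inter> {x \<in> V. g x = 0}"
      using irr[unfolded irreducible_closedin_def, THEN conjunct2, THEN conjunct2,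
          rule_format, OF conjI[OF cl[OF f] conjI[OF cl[OF g] eq]]] .
    then show "(\<forall>x\<in>Z. f x = 0) \<or> (\<forall>x\<in>Z. g x = 0)" by blast
  qed
  have eq: "Z = F \<or> Z = G" if R: "?R" and FG: "closedin X F" "closedin X G" "Z = F \<union> G" for F G
  proof (rule ccontr)
    assume ne: "\<not> (Z = F \<or> Z = G)"
    have sep: "\<exists>f. pol f \<and> (\<forall>x\<in>H. f x = 0) \<and> (\<exists>x\<in>Z. f x \<noteq> 0)"
      if H: "closedin X H" "H \<subseteq> Z" "H \<noteq> Z" for H
    proof -
      obtain x where "x \<in> Z" "x \<notin> H" using H by blast
      moreover from this obtain f where "pol f" "\<And>y. y \<in> H \<Longrightarrow> f y = 0" "f x \<noteq> 0"
        using closedin_separate[OF H(1)] closedin_subset_V[OF assms] by blast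
      ultimately show ?thesis by blast
    qed
    obtain f where f: "pol f" "\<forall>x\<in>F. f x = 0" "\<exists>x\<in>Z. f x \<noteq> 0" using sep[of F] FG ne by blast
    obtain g where g: "pol g" "\<forall>x\<in>G. g x = 0" "\<exists>x\<in>Z. g x \<noteq> 0" using sep[of G] FG ne by blast
    have "\<forall>x\<in>Z. f x * g x = 0" using f g FG by auto
    then show False using R f g by blast
  qed
  show ?thesis
  proof
    assume irr: "irreducible_closedin X Z"
    then show "Z \<noteq> {} \<and> ?R"
      using R[OF irr] unfolding irreducible_closedin_def by (intro conjI; elim conjE)
  next
    assume "Z \<noteq> {} \<and> ?R"
    then show "irreducible_closedin X Z"
      unfolding irreducible_closedin_def
      by (intro conjI allI impI assms; elim conjE) (assumption | rule eq)+
  qed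
qed

lemma V_nonempty: "(\<lambda>j\<in>J. \<lambda>a. 0) \<in> V"
  using dual_zero by auto

lemma irreducible_V: "irreducible_closedin X V"
proof -
  have "closedin X V" using closedin_topspace topspace_zariski by metis
  then show ?thesis unfolding irreducible_iff[OF \<open>closedin X V\<close>]
  proof (intro conjI allI impI)
    show "V \<noteq> {}" using V_nonempty by (rule ex_in_conv[THEN iffD1, OF exI])
  next
    fix f g assume "pol f \<and> pol g \<and> (\<forall>x\<in>V. f x * g x = 0)"
    then show "(\<forall>x\<in>V. f x = 0) \<or> (\<forall>x\<in>V. g x = 0)"
      using pol_vanish[of f g] by metis
  qed
qed

definition zclosure :: "(nat \<Rightarrow> 'a \<Rightarrow> complex) set \<Rightarrow> (nat \<Rightarrow> 'a \<Rightarrow> complex) set" where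
  "zclosure G = {x \<in> V. \<forall>f. pol f \<and> (\<forall>y\<in>G. f y = 0) \<longrightarrow> f x = 0}"

lemma closedin_zclosure: "closedin X (zclosure G)"
  unfolding closedin_pol zclosure_def
  by (rule exI[of _ "{f. pol f \<and> (\<forall>y\<in>G. f y = 0)}"]) auto

lemma zclosure_superset: "G \<subseteq> V \<Longrightarrow> G \<subseteq> zclosure G"
  by (auto simp: zclosure_def)

lemma zclosure_vanish: "pol f \<Longrightarrow> (\<And>y. y \<in> G \<Longrightarrow> f y = 0) \<Longrightarrow> x \<in> zclosure G \<Longrightarrow> f x = 0"
  by (auto simp: zclosure_def)


subsection \<open>Multilinear functions\<close>

text \<open>Forms in different sets of blocks are all functions on the full product
  \<open>V\<close>, constant in the blocks outside \<open>K\<close>, so that they can be multiplied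
  and compared without changing the domain.\<close>

definition mlin :: "nat set \<Rightarrow> ((nat \<Rightarrow> 'a \<Rightarrow> complex) \<Rightarrow> complex) \<Rightarrow> bool" where
  "mlin K f \<longleftrightarrow> K \<subseteq> J \<and>
     (\<forall>x\<in>V. \<forall>i\<in>J. \<forall>u\<in>D i.
        (i \<in> K \<longrightarrow> (\<forall>v\<in>D i. f (x(i := (\<lambda>a. u a + v a))) = f (x(i := u)) + f (x(i := v))) \<and>
                  (\<forall>c. f (x(i := (\<lambda>a. c * u a))) = c * f (x(i := u)))) \<and>
        (i \<notin> K \<longrightarrow> f (x(i := u)) = f x))"

lemma mlin_subset: "mlin K f \<Longrightarrow> K \<subseteq> J"
  by (simp add: mlin_def)

lemma mlin_add:
  "mlin K f \<Longrightarrow> x \<in> V \<Longrightarrow> i \<in> K \<Longrightarrow> u \<in> D i \<Longrightarrow> v \<in> D i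
    \<Longrightarrow> f (x(i := (\<lambda>a. u a + v a))) = f (x(i := u)) + f (x(i := v))"
  unfolding mlin_def by blast

lemma mlin_scale:
  "mlin K f \<Longrightarrow> x \<in> V \<Longrightarrow> i \<in> K \<Longrightarrow> u \<in> D i \<Longrightarrow> f (x(i := (\<lambda>a. c * u a))) = c * f (x(i := u))"
  unfolding mlin_def by blast

lemma mlin_indep: "mlin K f \<Longrightarrow> x \<in> V \<Longrightarrow> i \<in> J - K \<Longrightarrow> u \<in> D i \<Longrightarrow> f (x(i := u)) = f x"
  unfolding mlin_def by blast

lemma mlin_zero: "mlin K f \<Longrightarrow> x \<in> V \<Longrightarrow> i \<in> K \<Longrightarrow> f (x(i := (\<lambda>a. 0))) = 0"
  using mlin_scale[of K f x i "\<lambda>a. 0" 0] dual_zero by simp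

lemma mlin_axpy:
  assumes "mlin K f" "x \<in> V" "i \<in> K" "u \<in> D i" "v \<in> D i"
  shows "f (x(i := (\<lambda>a. u a + c * v a))) = f (x(i := u)) + c * f (x(i := v))"
  using mlin_add[OF assms(1-4) dual_scale[OF assms(5), of c]] mlin_scale[OF assms(1-3,5)] by simp

lemma mlin_sum:
  assumes "mlin K f" "x \<in> V" "i \<in> K" "finite B" "\<And>b. b \<in> B \<Longrightarrow> \<delta> b \<in> D i"
  shows "f (x(i := (\<lambda>a. \<Sum>b\<in>B. c b * \<delta> b a))) = (\<Sum>b\<in>B. c b * f (x(i := \<delta> b)))"
    and "(\<lambda>a. \<Sum>b\<in>B. c b * \<delta> b a) \<in> D i"
proof -
  have "f (x(i := (\<lambda>a. \<Sum>b\<in>B. c b * \<delta> b a))) = (\<Sum>b\<in>B. c b * f (x(i := \<delta> b))) \<and>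
      (\<lambda>a. \<Sum>b\<in>B. c b * \<delta> b a) \<in> D i"
    using assms(4,5)
  proof (induction rule: finite_induct)
    case empty
    then show ?case using mlin_zero[OF assms(1-3)] dual_zero by (simp del: fun_upd_apply)
  next
    case (insert b B)
    then have b: "\<delta> b \<in> D i" and B: "(\<lambda>a. \<Sum>b\<in>B. c b * \<delta> b a) \<in> D i" by auto
    show ?case
      using insert mlin_axpy[OF assms(1-3) B b] dual_axpy[OF B b] by (simp add: add.commute del: fun_upd_apply)
  qed
  then show "f (x(i := (\<lambda>a. \<Sum>b\<in>B. c b * \<delta> b a))) = (\<Sum>b\<in>B. c b * f (x(i := \<delta> b)))"
    and "(\<lambda>a. \<Sum>b\<in>B. c b * \<delta> b a) \<in> D i" by auto
qed

lemma override_insert: "override_on z x (insert i S) = (override_on z x S)(i := x i)"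
  by (auto simp: override_on_def)

text \<open>The blocks are released one at a time: those in \<open>S\<close> vary with
  \<open>x\<close>, the others are frozen at \<open>z\<close>. Releasing block \<open>i\<close>
  expands it in a dual basis.\<close>

lemma mlin_pol:
  assumes f: "mlin K f"
  shows "pol f"
proof -
  have "pol (\<lambda>x. f (override_on z x S))" if "finite S" "S \<subseteq> J" "z \<in> V" for z S
    using that
  proof (induction arbitrary: z rule: finite_induct)
    case empty
    show ?case by (simp add: pol_const)
  next
    case (insert i S)
    then have i: "i \<in> J" and iS: "i \<notin> S" and z: "z \<in> V" by auto
    show ?case
    proof (cases "i \<in> K")
      case False
      have "pol (\<lambda>x. f (override_on z x S))" using insert by auto
      then show ?thesis
      proof (rule pol_cong)
        fix x assume x: "x \<in> V"
        show "f (override_on z x S) = f (override_on z x (insert i S))"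
          unfolding override_insert using mlin_indep[OF f V_override[OF z x] _ V_mem[OF x i]] False i by simp
      qed
    next
      case True
      obtain B \<delta> where B: "finite B" "B \<subseteq> A i" "\<And>b. b \<in> B \<Longrightarrow> \<delta> b \<in> D i"
        and rep: "\<And>u. u \<in> D i \<Longrightarrow> u = (\<lambda>a. \<Sum>b\<in>B. u b * \<delta> b a)"
        using dual_basis[OF fin_dim[OF i]] by metis
      \<comment> \<open>Each coefficient \<open>x i b\<close> is a coordinate, and each remaining
        factor is an instance of the induction hypothesis with block \<open>i\<close> frozen at
        \<open>\<delta> b\<close>; this is why \<open>z\<close> must be arbitrary in the
        induction.\<close>
      have "pol (\<lambda>x. \<Sum>b\<in>B. x i b * f (override_on (z(i := \<delta> b)) x S))"
        using B i z insert by (intro pol_sum pol_mult pol_coord) (auto intro!: insert.IH V_update)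
      then show ?thesis
      proof (rule pol_cong)
        fix x assume x: "x \<in> V"
        let ?y = "override_on z x S"
        have "f (override_on z x (insert i S)) = f (?y(i := (\<lambda>a. \<Sum>b\<in>B. x i b * \<delta> b a)))"
          unfolding override_insert using rep[OF V_mem[OF x i]] by simp
        also have "\<dots> = (\<Sum>b\<in>B. x i b * f (?y(i := \<delta> b)))"
          using mlin_sum(1)[OF f V_override[OF z x] True B(1,3)] .
        also have "\<dots> = (\<Sum>b\<in>B. x i b * f (override_on (z(i := \<delta> b)) x S))"
          using iS by (intro sum.cong refl arg_cong2[where f="(*)"] arg_cong[where f=f])
            (auto simp: override_on_def)
        finally show "(\<Sum>b\<in>B. x i b * f (override_on (z(i := \<delta> b)) x S)) = f (override_on z x (insert i S))"
          by simp
      qed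
    qed
  qed
  from this[OF finite_J order_refl V_nonempty] show ?thesis
  proof (rule pol_cong)
    fix x assume "x \<in> V"
    then have "override_on (\<lambda>j\<in>J. \<lambda>a. 0) x J = x"
      by (auto simp: override_on_def PiE_iff extensional_def)
    then show "f (override_on (\<lambda>j\<in>J. \<lambda>a. 0) x J) = f x" by simp
  qed
qed

lemma mlin_override_indep:
  assumes "mlin K f" "x \<in> V" "z \<in> V" "finite S" "S \<subseteq> J - K"
  shows "f (override_on x z S) = f x"
  using assms(4,5)
proof (induction rule: finite_induct)
  case (insert i S)
  then show ?case
    unfolding override_insert
    using mlin_indep[OF assms(1) V_override[OF assms(2,3)]] V_mem[OF assms(3)] by (auto simp del: fun_upd_apply)
qed auto

text \<open>Contraction uses up one block; in the converse direction this contradicts the minimal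
  number of blocks.\<close>

lemma mlin_contract:
  assumes "mlin K f" "i \<in> K" "e \<in> D i"
  shows "mlin (K - {i}) (\<lambda>x. f (x(i := e)))"
  unfolding mlin_def
proof (intro conjI ballI impI)
  have KJ: "K \<subseteq> J" using assms mlin_subset by blast
  then show "K - {i} \<subseteq> J" by blast
  have i: "i \<in> J" using KJ assms by blast
  fix x j u assume x: "x \<in> V" and j: "j \<in> J" and u: "u \<in> D j"
  have x': "x(i := e) \<in> V" using x i assms V_update by blast
  { fix v assume "j \<in> K - {i}" "v \<in> D j"
    then show "f (x(j := (\<lambda>a. u a + v a), i := e)) = f (x(j := u, i := e)) + f (x(j := v, i := e))"
      using mlin_add[OF assms(1) x' _ u] by (auto simp: fun_upd_twist) }
  { assume "j \<in> K - {i}"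
    then show "\<forall>c. f (x(j := (\<lambda>a. c * u a), i := e)) = c * f (x(j := u, i := e))"
      using mlin_scale[OF assms(1) x' _ u] by (auto simp: fun_upd_twist) }
  { assume "j \<notin> K - {i}"
    then show "f (x(j := u, i := e)) = f (x(i := e))"
      using mlin_indep[OF assms(1) x' _ u] j by (cases "j = i") (auto simp: fun_upd_twist) }
qed

end


subsection \<open>The graph of a multilinear form solved for one coordinate\<close>

text \<open>Along the direction \<open>e\<close> in block \<open>i\<close> the form \<open>P\<close>
  is affine with slope \<open>P (x(i := e))\<close>. Where the slope is nonzero,
  \<open>P = 0\<close> can be solved for the coordinate along \<open>e\<close>.\<close>

locale multilinear_graph = dual_product scale A J
  for scale :: "complex \<Rightarrow> 'a::ab_group_add \<Rightarrow> 'a" and A J +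
  fixes K :: "nat set" and P :: "(nat \<Rightarrow> 'a \<Rightarrow> complex) \<Rightarrow> complex"
    and i :: nat and e :: "'a \<Rightarrow> complex"
  assumes mlin_P: "mlin K P" and i_K: "i \<in> K" and e_D: "e \<in> D i"
    and contract_nonzero: "\<exists>x\<in>V. P (x(i := e)) \<noteq> 0"
begin

lemma i_J: "i \<in> J"
  using mlin_subset[OF mlin_P] i_K by blast

definition a :: "(nat \<Rightarrow> 'a \<Rightarrow> complex) \<Rightarrow> complex" where
  "a x = P (x(i := e))"

text \<open>Over \<open>a \<noteq> 0\<close> every line in direction \<open>e\<close> meets
  \<open>P = 0\<close> in exactly one point, so \<open>G\<close> is a graph over the quotient by
  that direction.\<close>

definition G :: "(nat \<Rightarrow> 'a \<Rightarrow> complex) set" where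
  "G = {x \<in> V. P x = 0 \<and> a x \<noteq> 0}"

definition shift :: "complex \<Rightarrow> (nat \<Rightarrow> 'a \<Rightarrow> complex) \<Rightarrow> nat \<Rightarrow> 'a \<Rightarrow> complex" where
  "shift s x = x(i := (\<lambda>c. x i c + s * e c))"

text \<open>A vector on which \<open>e\<close> is nonzero; evaluation there, divided by
  \<open>e \<alpha>\<close>, gives a coordinate \<open>t\<close> that grows by \<open>s\<close>
  under \<open>shift s\<close>.\<close>

definition \<alpha> :: 'a where
  "\<alpha> = (SOME c. c \<in> A i \<and> e c \<noteq> 0)"

definition t :: "(nat \<Rightarrow> 'a \<Rightarrow> complex) \<Rightarrow> complex" where
  "t x = x i \<alpha> / e \<alpha>"

text \<open>These are the polynomials on the quotient by the direction \<open>e\<close>. Stating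
  this as invariance avoids choosing a complement of \<open>e\<close>.\<close>

definition shift_inv :: "((nat \<Rightarrow> 'a \<Rightarrow> complex) \<Rightarrow> complex) \<Rightarrow> bool" where
  "shift_inv f \<longleftrightarrow> pol f \<and> (\<forall>x\<in>V. \<forall>s. f (shift s x) = f x)"

lemma \<alpha>: "\<alpha> \<in> A i" "e \<alpha> \<noteq> 0"
proof -
  have "e \<noteq> (\<lambda>c. 0)"
    using contract_nonzero mlin_zero[OF mlin_P _ i_K] by metis
  then obtain c where "e c \<noteq> 0" by blast
  moreover from this have "c \<in> A i" using e_D unfolding dual_space_def by blast
  ultimately have "\<exists>c. c \<in> A i \<and> e c \<noteq> 0" by blast
  from someI_ex[OF this] show "\<alpha> \<in> A i" "e \<alpha> \<noteq> 0" unfolding \<alpha>_def by auto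
qed

lemma shift_V: "x \<in> V \<Longrightarrow> shift s x \<in> V"
  unfolding shift_def by (intro V_update i_J dual_axpy V_mem e_D)

lemma P_shift: "x \<in> V \<Longrightarrow> P (shift s x) = P x + s * a x"
  unfolding shift_def a_def using mlin_axpy[OF mlin_P _ i_K V_mem e_D, of x x s] i_J by simp

lemma a_shift: "a (shift s x) = a x"
  by (simp add: a_def shift_def)

lemma t_shift: "t (shift s x) = t x + s"
  using \<alpha> by (simp add: t_def shift_def field_simps)

lemma pol_a: "pol a"
  using mlin_pol[OF mlin_contract[OF mlin_P i_K e_D]] by (simp add: a_def[abs_def])

lemma pol_P: "pol P"
  by (rule mlin_pol[OF mlin_P])

lemma pol_t: "pol t"
  using pol_mult[OF pol_const[of "1 / e \<alpha>"] pol_coord[OF i_J \<alpha>(1)]] by (simp add: t_def[abs_def])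

lemma inv_pol: "shift_inv f \<Longrightarrow> pol f"
  by (simp add: shift_inv_def)

lemma inv_a: "shift_inv a"
  by (simp add: shift_inv_def pol_a a_shift)

lemma inv_const: "shift_inv (\<lambda>x. c)"
  by (simp add: shift_inv_def pol_const)

lemma inv_add: "shift_inv f \<Longrightarrow> shift_inv g \<Longrightarrow> shift_inv (\<lambda>x. f x + g x)"
  by (simp add: shift_inv_def pol_add)

lemma inv_mult: "shift_inv f \<Longrightarrow> shift_inv g \<Longrightarrow> shift_inv (\<lambda>x. f x * g x)"
  by (simp add: shift_inv_def pol_mult)

lemma inv_diff: "shift_inv f \<Longrightarrow> shift_inv g \<Longrightarrow> shift_inv (\<lambda>x. f x - g x)"
  by (simp add: shift_inv_def pol_diff)

lemma inv_power: "shift_inv f \<Longrightarrow> shift_inv (\<lambda>x. f x ^ d)"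
  by (simp add: shift_inv_def pol_power)

text \<open>Both \<open>P\<close> and \<open>t * a\<close> grow by \<open>s * a\<close> under
  \<open>shift s\<close>. Hence \<open>P\<close> is linear in \<open>t\<close> with leading
  coefficient \<open>a\<close> and an invariant constant term.\<close>

lemma inv_remainder: "shift_inv (\<lambda>x. P x - t x * a x)"
  unfolding shift_inv_def using pol_P pol_t pol_a
  by (auto simp: P_shift a_shift t_shift algebra_simps intro!: pol_diff pol_mult)

text \<open>The set \<open>a \<noteq> 0\<close> is dense, since \<open>V\<close> is irreducible and
  \<open>a\<close> is not identically zero on it.\<close>

lemma a_vanish:
  assumes "pol f" "\<And>x. x \<in> V \<Longrightarrow> a x \<noteq> 0 \<Longrightarrow> f x = 0" "x \<in> V"
  shows "f x = 0"
proof -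
  obtain z where "z \<in> V" "a z \<noteq> 0" using contract_nonzero unfolding a_def by blast
  moreover have "a x * f x = 0" if "x \<in> V" for x using assms(2)[OF that] by auto
  ultimately show ?thesis using pol_vanish[OF pol_a assms(1) _ _ _ assms(3)] by blast
qed

lemma shift_G: "x \<in> V \<Longrightarrow> a x \<noteq> 0 \<Longrightarrow> shift (- P x / a x) x \<in> G"
  unfolding G_def by (simp add: shift_V P_shift a_shift)

text \<open>Every point with \<open>a \<noteq> 0\<close> can be shifted into \<open>G\<close>
  without changing \<open>f\<close>; density does the rest.\<close>

lemma inv_vanish:
  assumes "shift_inv f" "\<And>x. x \<in> G \<Longrightarrow> f x = 0" "x \<in> V"
  shows "f x = 0"
proof (rule a_vanish[OF inv_pol[OF assms(1)] _ assms(3)])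
  fix x assume x: "x \<in> V" "a x \<noteq> 0"
  have "f x = f (shift (- P x / a x) x)" using assms(1) x by (simp add: shift_inv_def)
  then show "f x = 0" using assms(2)[OF shift_G[OF x]] by simp
qed

lemma G_nonempty: "G \<noteq> {}"
  using contract_nonzero shift_G unfolding a_def[symmetric] by blast

lemma G_V: "G \<subseteq> V"
  by (auto simp: G_def)

section \<open>Expansion in powers of \<open>t\<close> and pseudo-division by
  \<open>P\<close>\<close>

text \<open>\<open>rep d f\<close>: \<open>f\<close> is a polynomial in \<open>t\<close> of degree less than \<open>d\<close> with shift-invariant coefficients.\<close>

primrec rep :: "nat \<Rightarrow> ((nat \<Rightarrow> 'a \<Rightarrow> complex) \<Rightarrow> complex) \<Rightarrow> bool" where
  "rep 0 f \<longleftrightarrow> (\<forall>x\<in>V. f x = 0)"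
| "rep (Suc d) f \<longleftrightarrow> (\<exists>g h. rep d g \<and> shift_inv h \<and> (\<forall>x\<in>V. f x = t x * g x + h x))"

lemma rep_SucI: "rep d g \<Longrightarrow> shift_inv h \<Longrightarrow> (\<And>x. x \<in> V \<Longrightarrow> f x = t x * g x + h x) \<Longrightarrow> rep (Suc d) f"
  by auto

lemma rep_SucE:
  assumes "rep (Suc d) f"
  obtains g h where "rep d g" "shift_inv h" "\<And>x. x \<in> V \<Longrightarrow> f x = t x * g x + h x"
  using assms by auto

declare rep.simps(2) [simp del]

lemma rep_mono: "rep d f \<Longrightarrow> rep (d + k) f"
proof -
  have "rep (Suc d) f" if "rep d f" for d f
    using that
  proof (induction d arbitrary: f)
    case 0
    then show ?case by (intro rep_SucI[OF _ inv_const[of 0], of 0 "\<lambda>x. 0"]) auto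
  next
    case (Suc d)
    from Suc.prems show ?case
      by (rule rep_SucE) (rule rep_SucI[OF Suc.IH])
  qed
  then show "rep d f \<Longrightarrow> rep (d + k) f"
    by (induction k) auto
qed

lemma rep_inv: "shift_inv f \<Longrightarrow> rep 1 f"
  unfolding One_nat_def by (rule rep_SucI[of 0 "\<lambda>x. 0" f]) auto

lemma rep_add_same: "rep d f \<Longrightarrow> rep d g \<Longrightarrow> rep d (\<lambda>x. f x + g x)"
proof (induction d arbitrary: f g)
  case (Suc d)
  from Suc.prems(1) obtain f1 f0 where f: "rep d f1" "shift_inv f0" "\<And>x. x \<in> V \<Longrightarrow> f x = t x * f1 x + f0 x"
    by (rule rep_SucE) (rule that)
  from Suc.prems(2) obtain g1 g0 where g: "rep d g1" "shift_inv g0" "\<And>x. x \<in> V \<Longrightarrow> g x = t x * g1 x + g0 x"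
    by (rule rep_SucE) (rule that)
  show ?case
    using f(3) g(3) by (intro rep_SucI[OF Suc.IH[OF f(1) g(1)] inv_add[OF f(2) g(2)]]) (simp add: algebra_simps)
qed simp

lemma rep_add: "rep d f \<Longrightarrow> rep k g \<Longrightarrow> rep (d + k) (\<lambda>x. f x + g x)"
  using rep_add_same[OF rep_mono[of d f k] rep_mono[of k g d, unfolded add.commute[of k d]]] .

lemma rep_inv_mult: "shift_inv c \<Longrightarrow> rep d f \<Longrightarrow> rep d (\<lambda>x. c x * f x)"
proof (induction d arbitrary: f)
  case (Suc d)
  from Suc.prems(2) obtain f1 f0 where f: "rep d f1" "shift_inv f0" "\<And>x. x \<in> V \<Longrightarrow> f x = t x * f1 x + f0 x"
    by (rule rep_SucE) (rule that)
  show ?case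
    using f(3) by (intro rep_SucI[OF Suc.IH[OF Suc.prems(1) f(1)] inv_mult[OF Suc.prems(1) f(2)]])
      (simp add: algebra_simps)
qed simp

lemma rep_cong: "rep d f \<Longrightarrow> (\<And>x. x \<in> V \<Longrightarrow> g x = f x) \<Longrightarrow> rep d g"
  by (cases d) (auto simp: rep.simps(2))

lemma rep_mult: "rep d f \<Longrightarrow> rep k g \<Longrightarrow> \<exists>m. rep m (\<lambda>x. f x * g x)"
proof (induction d arbitrary: f)
  case 0
  then show ?case by (intro exI[of _ 0]) simp
next
  case (Suc d)
  from Suc.prems(1) obtain f1 f0 where f: "rep d f1" "shift_inv f0" "\<And>x. x \<in> V \<Longrightarrow> f x = t x * f1 x + f0 x"
    by (rule rep_SucE) (rule that)
  obtain m where "rep m (\<lambda>x. f1 x * g x)" using Suc.IH[OF f(1) Suc.prems(2)] by blast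
  then have "rep (Suc m) (\<lambda>x. t x * (f1 x * g x))"
    by (rule rep_SucI[OF _ inv_const[of 0]]) simp
  then have "rep (Suc m + k) (\<lambda>x. t x * (f1 x * g x) + f0 x * g x)"
    by (rule rep_add[OF _ rep_inv_mult[OF f(2) Suc.prems(2)]])
  then have "rep (Suc m + k) (\<lambda>x. f x * g x)"
    by (rule rep_cong) (simp add: f(3) algebra_simps)
  then show ?case by blast
qed

lemma rep_pol: "rep d f \<Longrightarrow> pol f"
proof (induction d arbitrary: f)
  case 0
  then show ?case by (auto intro: pol_cong[OF pol_const[of 0]])
next
  case (Suc d)
  from Suc.prems show ?case
  proof (rule rep_SucE)
    fix g h assume *: "rep d g" "shift_inv h" "\<And>x. x \<in> V \<Longrightarrow> f x = t x * g x + h x"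
    have "pol (\<lambda>x. t x * g x + h x)"
      using Suc.IH[OF *(1)] inv_pol[OF *(2)] pol_t by (intro pol_add pol_mult)
    then show ?thesis by (rule pol_cong) (simp add: *(3))
  qed
qed

lemma pol_rep:
  assumes "pol f"
  shows "\<exists>d. rep d f"
proof -
  obtain g where g: "polynomial_fun A J g" "\<And>x. x \<in> V \<Longrightarrow> f x = g x"
    using assms unfolding pol_def by metis
  from g(1) have "\<exists>d. rep d g"
  proof induction
    case (const c)
    then show ?case using rep_inv[OF inv_const] by blast
  next
    case (coord j c)
    show ?case
    proof (cases "j = i")
      case False
      then have "shift_inv (\<lambda>x. x j c)"
        unfolding shift_inv_def shift_def using coord by (simp add: pol_coord)
      then show ?thesis using rep_inv by blast
    next
      case True
      \<comment> \<open>A coordinate of block \<open>i\<close> changes by \<open>s * e c\<close>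
        under \<open>shift s\<close>, exactly as \<open>e c * t\<close> does, so it is linear in
        \<open>t\<close> with constant slope \<open>e c\<close>.\<close>
      have "pol (\<lambda>x. x j c - e c * t x)"
        using coord by (intro pol_diff pol_mult pol_coord pol_const pol_t)
      then have "shift_inv (\<lambda>x. x j c - e c * t x)"
        unfolding shift_inv_def using True by (simp add: t_shift) (simp add: shift_def algebra_simps)
      then have "rep (Suc 1) (\<lambda>x. x j c)"
        by (rule rep_SucI[OF rep_inv[OF inv_const[of "e c"]]]) simp
      then show ?thesis by blast
    qed
  next
    case (add f g)
    then show ?case using rep_add by blast
  next
    case (mult f g)
    then show ?case using rep_mult by blast
  qed
  then show ?thesis using rep_cong g(2) by blast
qed

text \<open>Induction along the Horner form \<open>f = t * g + h\<close>: divide \<open>g\<close>,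
  multiply by one more \<open>a\<close>, and rewrite the product \<open>t * a\<close> that meets the
  remainder of \<open>g\<close>.\<close>

lemma pseudo_division:
  "rep (Suc d) f \<Longrightarrow> \<exists>q r. rep d q \<and> shift_inv r \<and> (\<forall>x\<in>V. a x ^ d * f x = P x * q x + r x)"
proof (induction d arbitrary: f)
  case 0
  then obtain g h where "rep 0 g" "shift_inv h" "\<And>x. x \<in> V \<Longrightarrow> f x = t x * g x + h x"
    by (rule rep_SucE) (rule that)
  then show ?case
    by (intro exI[of _ "\<lambda>x. 0"] exI[of _ h]) simp
next
  case (Suc d)
  from Suc.prems obtain g h where gh: "rep (Suc d) g" "shift_inv h" "\<And>x. x \<in> V \<Longrightarrow> f x = t x * g x + h x"
    by (rule rep_SucE) (rule that)
  obtain q r where q: "rep d q" and r: "shift_inv r"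
    and qr: "\<And>x. x \<in> V \<Longrightarrow> a x ^ d * g x = P x * q x + r x"
    using Suc.IH[OF gh(1)] by blast
  \<comment> \<open>The constant term of \<open>P\<close> in \<open>t\<close>, so that
    \<open>t * a = P - ?b\<close>: the first summand goes into the quotient, the second into the
    invariant remainder.\<close>
  let ?b = "\<lambda>x. P x - t x * a x"
  have "rep (Suc d) (\<lambda>x. t x * (a x * q x) + r x)"
    by (rule rep_SucI[OF rep_inv_mult[OF inv_a q] r refl])
  moreover have "shift_inv (\<lambda>x. a x ^ Suc d * h x - ?b x * r x)"
    by (intro inv_diff inv_mult inv_power inv_a inv_remainder gh r)
  moreover have "a x ^ Suc d * f x
      = P x * (t x * (a x * q x) + r x) + (a x ^ Suc d * h x - ?b x * r x)" if "x \<in> V" for x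
  proof -
    have "a x ^ Suc d * f x = t x * a x * (a x ^ d * g x) + a x ^ Suc d * h x"
      by (simp add: gh(3)[OF that] algebra_simps)
    also have "\<dots> = P x * (t x * (a x * q x) + r x) + (a x ^ Suc d * h x - ?b x * r x)"
      unfolding qr[OF that] by (simp add: algebra_simps)
    finally show ?thesis .
  qed
  ultimately show ?case by blast
qed

section \<open>Irreducibility and maximality of the closure of the graph\<close>

lemma pol_on_G:
  assumes "pol f"
  obtains d r where "shift_inv r" "\<And>x. x \<in> G \<Longrightarrow> a x ^ d * f x = r x"
proof -
  obtain d where "rep d f" using pol_rep[OF assms] by blast
  then have "rep (Suc d) f" using rep_mono[of d f 1] by simp
  \<comment> \<open>On \<open>G\<close> the multiple of \<open>P\<close> disappears, so there
    \<open>f\<close> equals the rational function \<open>r / a ^ d\<close> of the base.\<close>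
  from pseudo_division[OF this] obtain q r where
    "shift_inv r" "\<forall>x\<in>V. a x ^ d * f x = P x * q x + r x" by blast
  then show ?thesis using that[of r d] by (auto simp: G_def)
qed

text \<open>The question moves to the invariant remainders: their product vanishes on
  \<open>G\<close>, hence on \<open>V\<close>, and there one of them is zero. On \<open>G\<close>
  the powers of \<open>a\<close> cancel.\<close>

lemma G_prime:
  assumes "pol f" "pol g" "\<And>x. x \<in> G \<Longrightarrow> f x * g x = 0"
  shows "(\<forall>x\<in>G. f x = 0) \<or> (\<forall>x\<in>G. g x = 0)"
proof -
  obtain d r where r: "shift_inv r" "\<And>x. x \<in> G \<Longrightarrow> a x ^ d * f x = r x"
    by (rule pol_on_G[OF assms(1)]) (rule that)
  obtain k s where s: "shift_inv s" "\<And>x. x \<in> G \<Longrightarrow> a x ^ k * g x = s x"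
    by (rule pol_on_G[OF assms(2)]) (rule that)
  have "r x * s x = 0" if "x \<in> G" for x
    using assms(3)[OF that] r(2)[OF that] s(2)[OF that] by (metis mult_eq_0_iff)
  then have rs: "r x * s x = 0" if "x \<in> V" for x
    using inv_vanish[OF inv_mult[OF r(1) s(1)]] that by blast
  have "(\<forall>x\<in>V. r x = 0) \<or> (\<forall>x\<in>V. s x = 0)"
    using pol_vanish[OF inv_pol[OF r(1)] inv_pol[OF s(1)] rs] by metis
  then show ?thesis
    using r(2) s(2) unfolding G_def by auto
qed

lemma zclosure_G_irreducible: "irreducible_closedin X (zclosure G)"
  unfolding irreducible_iff[OF closedin_zclosure]
proof (intro conjI allI impI)
  have G: "G \<subseteq> zclosure G" by (rule zclosure_superset[OF G_V])
  then show "zclosure G \<noteq> {}" using G_nonempty by blast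
  fix f g assume *: "pol f \<and> pol g \<and> (\<forall>x\<in>zclosure G. f x * g x = 0)"
  then have "(\<forall>x\<in>G. f x = 0) \<or> (\<forall>x\<in>G. g x = 0)"
    using G by (intro G_prime) auto
  then show "(\<forall>x\<in>zclosure G. f x = 0) \<or> (\<forall>x\<in>zclosure G. g x = 0)"
    using * zclosure_vanish by blast
qed

lemma P_zclosure_G: "x \<in> zclosure G \<Longrightarrow> P x = 0"
  by (rule zclosure_vanish[OF pol_P]) (auto simp: G_def)

lemma zclosure_G_proper: "zclosure G \<subset> V"
proof -
  obtain x where "x \<in> V" "P (x(i := e)) \<noteq> 0" using contract_nonzero by blast
  then have "x(i := e) \<in> V - zclosure G"
    using P_zclosure_G V_update i_J e_D by blast
  moreover have "zclosure G \<subseteq> V" by (simp add: zclosure_def)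
  ultimately show ?thesis by blast
qed

lemma zclosure_G_maximal:
  assumes W: "irreducible_closedin X W" and "zclosure G \<subset> W"
  shows "W = V"
proof (rule ccontr)
  assume "W \<noteq> V"
  have cl: "closedin X W" using W by (simp add: irreducible_closedin_def)
  have prime: "(\<forall>x\<in>W. f x = 0) \<or> (\<forall>x\<in>W. g x = 0)"
    if "pol f" "pol g" "\<And>x. x \<in> W \<Longrightarrow> f x * g x = 0" for f g
    using W[unfolded irreducible_iff[OF cl]] that by blast
  have GW: "G \<subseteq> W" using zclosure_superset[OF G_V] assms(2) by blast
  have WV: "W \<subseteq> V" by (rule closedin_subset_V[OF cl])
  have nP: "\<not> (\<forall>x\<in>W. P x = 0)"
  proof
    assume P0: "\<forall>x\<in>W. P x = 0"
    obtain y where y: "y \<in> W" "y \<notin> zclosure G" using assms(2) by blast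
    then obtain f where f: "pol f" "\<And>x. x \<in> zclosure G \<Longrightarrow> f x = 0" "f y \<noteq> 0"
      using closedin_separate[OF closedin_zclosure] WV by blast
    \<comment> \<open>If \<open>P\<close> vanished on \<open>W\<close>, points of \<open>W\<close>
      with \<open>a \<noteq> 0\<close> would lie in \<open>G\<close>, where \<open>f\<close> is
      zero. But neither \<open>a\<close> nor \<open>f\<close> vanishes on all of
      \<open>W\<close>.\<close>
    have "a x * f x = 0" if "x \<in> W" for x
      using f(2)[of x] zclosure_superset[OF G_V] P0 that WV by (cases "a x = 0") (auto simp: G_def)
    then have "(\<forall>x\<in>W. a x = 0) \<or> (\<forall>x\<in>W. f x = 0)"
      by (rule prime[OF pol_a f(1)])
    then show False using f(3) y(1) G_nonempty GW by (auto simp: G_def)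
  qed
  \<comment> \<open>A polynomial vanishing on \<open>W\<close> is, up to powers of \<open>a\<close>, a multiple of \<open>P\<close>,
    and the cofactor vanishes on \<open>W\<close> again with smaller degree in \<open>t\<close>.\<close>
  have zero: "\<forall>x\<in>V. f x = 0" if "rep d f" "\<And>x. x \<in> W \<Longrightarrow> f x = 0" for d f
    using that
  proof (induction d arbitrary: f)
    case (Suc d)
    from pseudo_division[OF Suc.prems(1)] obtain q r where q: "rep d q" and r: "shift_inv r"
      and qr: "\<And>x. x \<in> V \<Longrightarrow> a x ^ d * f x = P x * q x + r x" by blast
    have "r x = 0" if "x \<in> G" for x
      using qr[of x] that Suc.prems(2)[of x] GW by (auto simp: G_def)
    then have r0: "r x = 0" if "x \<in> V" for x using inv_vanish[OF r] that by blast
    have "P x * q x = 0" if "x \<in> W" for x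
      using qr[of x] r0[of x] Suc.prems(2)[OF that] that WV by auto
    then have "\<forall>x\<in>W. q x = 0"
      using prime[OF pol_P rep_pol[OF q]] nP by blast
    then have "\<forall>x\<in>V. q x = 0" using Suc.IH[OF q] by blast
    then have "a x ^ d * f x = 0" if "x \<in> V" for x
      using qr[OF that] r0[OF that] that by simp
    then have "f x = 0" if "x \<in> V" for x
      using a_vanish[OF rep_pol[OF Suc.prems(1)] _ that] by (metis mult_eq_0_iff power_not_zero)
    then show ?case by blast
  qed simp
  obtain y where y: "y \<in> V" "y \<notin> W" using \<open>W \<noteq> V\<close> WV by blast
  obtain f where f: "pol f" "\<And>x. x \<in> W \<Longrightarrow> f x = 0" "f y \<noteq> 0"
    by (rule closedin_separate[OF cl y]) (rule that)
  obtain d where "rep d f" using pol_rep[OF f(1)] ..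
  from zero[OF this f(2)] show False using f(3) y(1) by blast
qed

text \<open>\<open>Q\<close> is affine along \<open>e\<close> as well and vanishes where the line
  through \<open>x\<close> meets \<open>G\<close>, at parameter \<open>- P x / a x\<close>. Clearing
  the denominator gives the identity on the dense set \<open>a \<noteq> 0\<close>. It says that
  \<open>Q / P\<close> is unchanged when block \<open>i\<close> is replaced by
  \<open>e\<close>.\<close>

lemma cross_mult:
  assumes Q: "mlin L Q" and L: "i \<in> L" and "\<And>x. x \<in> G \<Longrightarrow> Q x = 0" and "x \<in> V"
  shows "P (x(i := e)) * Q x = Q (x(i := e)) * P x"
proof -
  have pol: "pol (\<lambda>x. P (x(i := e)) * Q x - Q (x(i := e)) * P x)"
    by (intro pol_diff pol_mult mlin_pol[OF mlin_P] mlin_pol[OF Q]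
        mlin_pol[OF mlin_contract[OF mlin_P i_K e_D]] mlin_pol[OF mlin_contract[OF Q L e_D]])
  have "P (x(i := e)) * Q x - Q (x(i := e)) * P x = 0"
  proof (rule a_vanish[OF pol _ assms(4)])
    fix x assume x: "x \<in> V" "a x \<noteq> 0"
    have "Q (shift (- P x / a x) x) = 0"
      using assms(3)[OF shift_G[OF x]] .
    then have "Q x + (- P x / a x) * Q (x(i := e)) = 0"
      unfolding shift_def using mlin_axpy[OF Q x(1) L V_mem[OF x(1) i_J] e_D, of "- P x / a x"] by simp
    then show "P (x(i := e)) * Q x - Q (x(i := e)) * P x = 0"
      using x(2) unfolding a_def by (simp add: field_simps)
  qed
  then show ?thesis by simp
qed

end


subsection \<open>Codimension one\<close>

context dual_product
begin

lemma pol_override: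
  assumes "pol f" "p \<in> V"
  shows "pol (\<lambda>x. f (override_on x p R))"
proof -
  obtain g where g: "polynomial_fun A J g" "\<And>x. x \<in> V \<Longrightarrow> f x = g x"
    using assms(1) unfolding pol_def by metis
  from g(1) have "polynomial_fun A J (\<lambda>x. g (override_on x p R))"
  proof induction
    case (coord j c)
    then show ?case
      by (cases "j \<in> R") (auto simp: override_on_def intro: polynomial_fun.intros)
  qed (auto intro: polynomial_fun.intros)
  then show ?thesis
    unfolding pol_def using g(2) V_override[OF _ assms(2)] by blast
qed

text \<open>The case \<open>Z = V\<close> is included; in \<open>codim_eq_1_iff\<close> the
  condition \<open>\<not> V \<subseteq> Y\<close> rules it out.\<close>

definition codim_le_1 :: "(nat \<Rightarrow> 'a \<Rightarrow> complex) set \<Rightarrow> bool" where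
  "codim_le_1 Z \<longleftrightarrow> (\<forall>W. irreducible_closedin X W \<longrightarrow> Z \<subset> W \<longrightarrow> W = V)"

lemma codim_le_1D: "codim_le_1 Z \<Longrightarrow> irreducible_closedin X W \<Longrightarrow> Z \<subset> W \<Longrightarrow> W = V"
  unfolding codim_le_1_def by (elim allE impE)

text \<open>All irreducible closed sets lie in \<open>V\<close>, which is itself irreducible. So
  every chain can be continued up to \<open>V\<close>, and codimension 0 occurs only for
  \<open>V\<close>.\<close>

lemma codim_eq_1_iff:
  "codim X Y = 1 \<longleftrightarrow>
    \<not> V \<subseteq> Y \<and> (\<exists>Z. irreducible_closedin X Z \<and> codim_le_1 Z \<and> Z \<subseteq> Y)"
    (is "_ \<longleftrightarrow> _ \<and> ?R")
proof -
  define S where "S = {irreducible_codim X Z | Z. irreducible_closedin X Z \<and> Z \<subseteq> Y}"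
  have cod: "codim X Y = Inf S" by (simp add: codim_def S_def)
  have irr_V: "W \<subseteq> V" if "irreducible_closedin X W" for W
    using that closedin_subset_V by (simp add: irreducible_closedin_def)
  have chainI: "enat k \<le> irreducible_codim X Z"
    if "C 0 = Z" "\<And>j. j \<le> k \<Longrightarrow> irreducible_closedin X (C j)" "\<And>j. j < k \<Longrightarrow> C j \<subset> C (Suc j)"
    for C k Z
    unfolding irreducible_codim_def using that by (intro Sup_upper) blast
  have leI: "irreducible_codim X Z \<le> enat m"
    if "\<And>C k. C 0 = Z \<Longrightarrow> (\<And>j. j \<le> k \<Longrightarrow> irreducible_closedin X (C j)) \<Longrightarrow>
      (\<And>j. j < k \<Longrightarrow> C j \<subset> C (Suc j)) \<Longrightarrow> k \<le> m" for Z m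
    unfolding irreducible_codim_def using that by (intro Sup_least) auto
  show ?thesis
  proof
    assume 1: "codim X Y = 1"
    \<comment> \<open>The infimum of the empty set would be infinite. A nonempty set of extended
      naturals attains its infimum, which supplies \<open>Z\<close>.\<close>
    have "S \<noteq> {}"
    proof
      assume "S = {}"
      then show False using 1 cod by (simp add: Inf_enat_def)
    qed
    then have "Inf S \<in> S" unfolding Inf_enat_def by (auto intro: LeastI)
    then obtain Z where Z: "irreducible_closedin X Z" "Z \<subseteq> Y" "irreducible_codim X Z = 1"
      using 1 cod unfolding S_def by auto
    have "\<not> V \<subseteq> Y"
    proof
      assume "V \<subseteq> Y"
      then have "irreducible_codim X V \<in> S"
        unfolding S_def using irreducible_V by blast
      then have "1 \<le> irreducible_codim X V" using 1 cod by (metis Inf_lower)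
      also have "irreducible_codim X V \<le> enat 0"
      proof (rule leI, rule ccontr)
        fix C k assume C: "C 0 = V" "\<And>j. j \<le> k \<Longrightarrow> irreducible_closedin X (C j)"
          "\<And>j. j < k \<Longrightarrow> C j \<subset> C (Suc j)" and "\<not> k \<le> (0::nat)"
        then have "V \<subset> C 1" "C 1 \<subseteq> V" using C(3)[of 0] irr_V[OF C(2)[of 1]] by auto
        then show False by blast
      qed
      finally show False by (simp add: zero_enat_def[symmetric])
    qed
    moreover have "codim_le_1 Z"
      unfolding codim_le_1_def
    proof (intro allI impI)
      fix W assume W: "irreducible_closedin X W" "Z \<subset> W"
      show "W = V"
      proof (rule ccontr)
        assume "W \<noteq> V"
        \<comment> \<open>The chain \<open>Z \<subset> W \<subset> V\<close> of length 2.\<close>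
        define C where "C j = (if j = 0 then Z else if j = 1 then W else V)" for j :: nat
        have "enat 2 \<le> irreducible_codim X Z"
        proof (rule chainI)
          show "C 0 = Z" by (simp add: C_def)
          show "irreducible_closedin X (C j)" for j
            using Z W irreducible_V by (simp add: C_def)
          show "C j \<subset> C (Suc j)" if "j < 2" for j
            using that W \<open>W \<noteq> V\<close> irr_V[OF W(1)] by (cases "j = 0") (auto simp: C_def)
        qed
        then show False using Z(3) by (simp add: one_enat_def)
      qed
    qed
    ultimately show "\<not> V \<subseteq> Y \<and> ?R" using Z(1,2) by blast
  next
    assume R: "\<not> V \<subseteq> Y \<and> ?R"
    then obtain Z where Z: "irreducible_closedin X Z" "codim_le_1 Z" "Z \<subseteq> Y"
      by (elim exE conjE) (rule that)
    note max = codim_le_1D[OF Z(2)]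
    have "Inf S \<le> irreducible_codim X Z"
      unfolding S_def using Z by (intro Inf_lower) blast
    also have "irreducible_codim X Z \<le> enat 1"
    proof (rule leI, rule ccontr)
      fix C k assume C: "C 0 = Z" "\<And>j. j \<le> k \<Longrightarrow> irreducible_closedin X (C j)"
        "\<And>j. j < k \<Longrightarrow> C j \<subset> C (Suc j)" and k: "\<not> k \<le> (1::nat)"
      have "C 1 = V" using C(3)[of 0] C(1) k by (intro max C(2)) auto
      moreover have "C 1 \<subset> C 2" using C(3)[of 1] k by (simp add: numeral_2_eq_2)
      ultimately show False using irr_V[OF C(2)[of 2]] k by auto
    qed
    finally have "Inf S \<le> 1" by (simp add: one_enat_def)
    moreover have "1 \<le> Inf S"
    proof (rule Inf_greatest)
      fix s assume "s \<in> S"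
      then obtain U where U: "irreducible_closedin X U" "U \<subseteq> Y" "s = irreducible_codim X U"
        unfolding S_def by blast
      define C where "C j = (if j = 0 then U else V)" for j :: nat
      have "enat 1 \<le> irreducible_codim X U"
      proof (rule chainI)
        show "C 0 = U" by (simp add: C_def)
        show "irreducible_closedin X (C j)" for j
          using U irreducible_V by (simp add: C_def)
        show "C j \<subset> C (Suc j)" if "j < 1" for j
          using that U R irr_V[OF U(1)] by (auto simp: C_def)
      qed
      then show "1 \<le> s" by (simp add: U(3) one_enat_def)
    qed
    ultimately show "codim X Y = 1" using cod by simp
  qed
qed

section \<open>Tensors, their slices and their restrictions as multilinear functions on
  \<open>V\<close>\<close>

lemma tensors_nonzero:
  assumes "T \<in> tensors scale A I" "T \<noteq> zero_tensor scale A I"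
  obtains x where "x \<in> dual_prod scale A I" "T x \<noteq> 0"
proof -
  have "T \<in> extensional (dual_prod scale A I)" using assms(1) by (simp add: tensors_def)
  then have "\<exists>x\<in>dual_prod scale A I. T x \<noteq> 0"
    using assms(2) unfolding zero_tensor_def extensional_def restrict_def by fastforce
  then show ?thesis using that by blast
qed

lemma tensors_add:
  "T \<in> tensors scale A I \<Longrightarrow> x \<in> dual_prod scale A I \<Longrightarrow> i \<in> I \<Longrightarrow> u \<in> D i \<Longrightarrow> v \<in> D i
    \<Longrightarrow> T (x(i := (\<lambda>a. u a + v a))) = T (x(i := u)) + T (x(i := v))"
  unfolding tensors_def by blast

lemma tensors_scale:
  "T \<in> tensors scale A I \<Longrightarrow> x \<in> dual_prod scale A I \<Longrightarrow> i \<in> I \<Longrightarrow> u \<in> D i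
    \<Longrightarrow> T (x(i := (\<lambda>a. c * u a))) = c * T (x(i := u))"
  unfolding tensors_def by blast

lemma tensorsI:
  assumes "T \<in> extensional (dual_prod scale A I)"
    and "\<And>x i u v. x \<in> dual_prod scale A I \<Longrightarrow> i \<in> I \<Longrightarrow> u \<in> D i \<Longrightarrow> v \<in> D i
      \<Longrightarrow> T (x(i := (\<lambda>a. u a + v a))) = T (x(i := u)) + T (x(i := v))"
    and "\<And>x i u c. x \<in> dual_prod scale A I \<Longrightarrow> i \<in> I \<Longrightarrow> u \<in> D i
      \<Longrightarrow> T (x(i := (\<lambda>a. c * u a))) = c * T (x(i := u))"
  shows "T \<in> tensors scale A I"
  unfolding tensors_def using assms by simp

lemma dual_prod_update:
  "x \<in> dual_prod scale A I \<Longrightarrow> i \<in> I \<Longrightarrow> u \<in> D i \<Longrightarrow> x(i := u) \<in> dual_prod scale A I"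
  by (auto simp: PiE_iff extensional_def)

lemma restrict_V: "x \<in> V \<Longrightarrow> I \<subseteq> J \<Longrightarrow> restrict x I \<in> dual_prod scale A I"
  by auto

lemma V_extend: "x \<in> V \<Longrightarrow> y \<in> D n \<Longrightarrow> x(n := y) \<in> dual_prod scale A (insert n J)"
  by (auto simp: PiE_iff extensional_def)

lemma tensor_slice_mlin:
  assumes "T \<in> tensors scale A (insert n J)" "n \<notin> J" "y \<in> D n"
  shows "mlin J (\<lambda>x. T (x(n := y)))"
  unfolding mlin_def
proof (intro conjI ballI impI allI)
  fix x i u assume x: "x \<in> V" and i: "i \<in> J" and u: "u \<in> D i"
  have x': "x(n := y) \<in> dual_prod scale A (insert n J)" using x assms(3) by (rule V_extend)
  have ne: "i \<noteq> n" using i assms(2) by auto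
  show "T (x(i := (\<lambda>a. u a + v a), n := y)) = T (x(i := u, n := y)) + T (x(i := v, n := y))"
    if "v \<in> D i" for v
    using tensors_add[OF assms(1) x' _ u that] i ne by (simp add: fun_upd_twist)
  show "T (x(i := (\<lambda>a. c * u a), n := y)) = c * T (x(i := u, n := y))" for c
    using tensors_scale[OF assms(1) x' _ u] i ne by (simp add: fun_upd_twist)
qed auto

lemma tensor_restrict_mlin:
  assumes T: "T \<in> tensors scale A I" and I: "I \<subseteq> J"
  shows "mlin I (\<lambda>x. T (restrict x I))"
  unfolding mlin_def
proof (intro conjI ballI impI allI)
  fix x i u assume x: "x \<in> V" and i: "i \<in> J" and u: "u \<in> D i"
  have x': "restrict x I \<in> dual_prod scale A I" by (rule restrict_V[OF x I])
  have upd: "restrict (x(i := w)) I = (restrict x I)(i := w)" if "i \<in> I" for w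
    using that by (auto simp: restrict_def)
  show "T (restrict (x(i := (\<lambda>a. u a + v a))) I)
      = T (restrict (x(i := u)) I) + T (restrict (x(i := v)) I)" if "i \<in> I" "v \<in> D i" for v
    unfolding upd[OF that(1)] by (rule tensors_add[OF T x' that(1) u that(2)])
  show "T (restrict (x(i := (\<lambda>a. c * u a))) I) = c * T (restrict (x(i := u)) I)" if "i \<in> I" for c
    unfolding upd[OF that] by (rule tensors_scale[OF T x' that u])
  show "T (restrict (x(i := u)) I) = T (restrict x I)" if "i \<notin> I"
    using that by (intro arg_cong[of _ _ T]) (auto simp: restrict_def)
qed (rule I)

section \<open>The two directions of the equivalence\<close>

lemma codim_1_of_factorization:
  assumes n: "n \<notin> J" "n \<in> I2" and part: "I1 \<union> I2 = insert n J" "I1 \<inter> I2 = {}" "I1 \<noteq> {}"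
    and T1: "T1 \<in> tensors scale A I1" "T1 \<noteq> zero_tensor scale A I1"
    and T2: "T2 \<in> tensors scale A I2" "T2 \<noteq> zero_tensor scale A I2"
    and T: "T = tensor_mult scale A I1 I2 T1 T2"
  shows "codim X {x \<in> V. \<forall>y\<in>D n. T (x(n := y)) = 0} = 1" (is "codim X ?Y = 1")
proof -
  have "n \<notin> I1" using n(2) part(2) by (metis IntI empty_iff)
  then have I1: "I1 \<subseteq> J" using part(1) by auto
  obtain x1 where x1: "x1 \<in> dual_prod scale A I1" "T1 x1 \<noteq> 0"
    using tensors_nonzero[OF T1] .
  obtain x2 where x2: "x2 \<in> dual_prod scale A I2" "T2 x2 \<noteq> 0"
    using tensors_nonzero[OF T2] .
  \<comment> \<open>Gluing points where \<open>T1\<close> and \<open>T2\<close> are nonzero gives a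
    point where \<open>T\<close> is nonzero, so the zero locus is not all of
    \<open>V\<close>.\<close>
  define w where "w = (\<lambda>j\<in>insert n J. if j \<in> I1 then x1 j else x2 j)"
  define z where "z = restrict w J"
  have w: "w \<in> dual_prod scale A (insert n J)"
    unfolding w_def using x1(1) x2(1) part(1) by (auto simp: PiE_iff)
  have z: "z \<in> V" unfolding z_def using w by auto
  have wz: "z(n := w n) = w"
    using w unfolding z_def by (auto simp: fun_eq_iff PiE_iff extensional_def)
  have I2: "I2 \<subseteq> insert n J" and disj: "\<And>j. j \<in> I2 \<Longrightarrow> j \<notin> I1"
    using part(1,2) by auto
  have w1: "restrict w I1 = x1"
    using I1 PiE_arb[OF x1(1)] by (fastforce simp: w_def restrict_def)
  have w2: "restrict w I2 = x2"
    using I2 disj PiE_arb[OF x2(1)] by (fastforce simp: w_def restrict_def)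
  have z1: "restrict z I1 = x1"
    unfolding w1[symmetric] z_def using I1 by (simp add: restrict_restrict Int_absorb1)
  have "T (z(n := w n)) = T1 x1 * T2 x2"
    using w by (simp add: wz T tensor_mult_def part w1 w2)
  then have "\<exists>y\<in>D n. T (z(n := y)) \<noteq> 0"
    using w x1 x2 by (intro bexI[of _ "w n"]) auto
  then have notin: "\<not> V \<subseteq> ?Y" using z by blast
  define P where "P x = T1 (restrict x I1)" for x
  have P: "mlin I1 P"
    using tensor_restrict_mlin[OF T1(1) I1] by (simp add: P_def[abs_def])
  obtain i where i: "i \<in> I1" using part by blast
  \<comment> \<open>With direction \<open>z i\<close> the contraction of \<open>P\<close> at
    \<open>z\<close> is \<open>P z = T1 x1\<close>, which is nonzero.\<close>
  interpret H: multilinear_graph scale A J I1 P i "z i"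
  proof
    show "mlin I1 P" by (rule P)
    show "i \<in> I1" by (rule i)
    show "z i \<in> D i" using V_mem[OF z] i I1 by blast
    show "\<exists>x\<in>V. P (x(i := z i)) \<noteq> 0"
      using z z1 x1(2) by (intro bexI[of _ z]) (auto simp: P_def)
  qed
  \<comment> \<open>The factor \<open>T1\<close> does not involve block \<open>n\<close>, so
    \<open>P\<close> divides every slice of \<open>T\<close>.\<close>
  have "zclosure H.G \<subseteq> ?Y"
  proof
    fix x assume x: "x \<in> zclosure H.G"
    then have xV: "x \<in> V" using H.zclosure_G_proper by blast
    have "T (x(n := y)) = 0" if "y \<in> D n" for y
    proof -
      have "x(n := y) \<in> dual_prod scale A (I1 \<union> I2)"
        unfolding part(1) using xV that by (rule V_extend)
      then have "T (x(n := y)) = T1 (restrict (x(n := y)) I1) * T2 (restrict (x(n := y)) I2)"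
        by (simp add: T tensor_mult_def del: fun_upd_apply)
      also have "restrict (x(n := y)) I1 = restrict x I1"
        using n I1 by (auto simp: restrict_def fun_eq_iff)
      finally show ?thesis using H.P_zclosure_G[OF x] by (metis P_def mult_zero_left)
    qed
    then show "x \<in> ?Y" using xV by blast
  qed
  then show ?thesis
    unfolding codim_eq_1_iff codim_le_1_def
    by (intro conjI exI[of _ "zclosure H.G"] allI impI notin H.zclosure_G_irreducible
        H.zclosure_G_maximal)
qed

lemma factorization_of_codim_1:
  assumes n: "n \<notin> J" and T: "T \<in> tensors scale A (insert n J)"
    and codim: "codim X {x \<in> V. \<forall>y\<in>D n. T (x(n := y)) = 0} = 1"
  obtains K T1 T2 where "K \<subseteq> J" "K \<noteq> {}"
    "T1 \<in> tensors scale A K" "T1 \<noteq> zero_tensor scale A K"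
    "T2 \<in> tensors scale A (insert n J - K)" "T2 \<noteq> zero_tensor scale A (insert n J - K)"
    "T = tensor_mult scale A K (insert n J - K) T1 T2"
proof -
  define Y where "Y = {x \<in> V. \<forall>y\<in>D n. T (x(n := y)) = 0}"
  have Y: "\<not> V \<subseteq> Y" "\<exists>Z. irreducible_closedin X Z \<and> codim_le_1 Z \<and> Z \<subseteq> Y"
    using codim[folded Y_def, unfolded codim_eq_1_iff] by (rule conjunct1, rule conjunct2)
  obtain Z where Z: "irreducible_closedin X Z" and le1: "codim_le_1 Z" and "Z \<subseteq> Y"
    using Y(2) by (elim exE conjE) (rule that)
  note max = codim_le_1D[OF le1]
  have ZY: "T (x(n := y)) = 0" if "x \<in> Z" "y \<in> D n" for x y
    using \<open>Z \<subseteq> Y\<close> that by (auto simp: Y_def)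
  obtain x0 y0 where xy0: "x0 \<in> V" "y0 \<in> D n" "T (x0(n := y0)) \<noteq> 0"
    using Y(1) unfolding Y_def by auto
  have clZ: "closedin X Z" and Z_ne: "Z \<noteq> {}" using Z by (auto simp: irreducible_closedin_def)
  have ZV: "Z \<subseteq> V" by (rule closedin_subset_V[OF clZ])
  have prime: "(\<forall>x\<in>Z. f x = 0) \<or> (\<forall>x\<in>Z. g x = 0)"
    if "pol f" "pol g" "\<And>x. x \<in> Z \<Longrightarrow> f x * g x = 0" for f g
    using Z[unfolded irreducible_iff[OF clZ]] that by blast
  define \<P> where "\<P> K P \<longleftrightarrow> mlin K P \<and> (\<forall>x\<in>Z. P x = 0) \<and> (\<exists>x\<in>V. P x \<noteq> 0)" for K P
  have "\<P> J (\<lambda>x. T (x(n := y0)))"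
    unfolding \<P>_def using tensor_slice_mlin[OF T n xy0(2)] ZY xy0 by blast
  then have "\<exists>K. \<exists>P. \<P> K P" by blast
  \<comment> \<open>Among the nonzero multilinear forms vanishing on \<open>Z\<close>, take one in
    the fewest blocks.\<close>
  from ex_has_least_nat[of "\<lambda>K. \<exists>P. \<P> K P" _ card] this
  obtain K P where KP: "\<P> K P" and min: "\<And>L Q. \<P> L Q \<Longrightarrow> card K \<le> card L" by blast
  have P: "mlin K P" and PZ: "\<And>x. x \<in> Z \<Longrightarrow> P x = 0" using KP by (auto simp: \<P>_def)
  obtain p where p: "p \<in> V" "P p \<noteq> 0" using KP by (auto simp: \<P>_def)
  have KJ: "K \<subseteq> J" by (rule mlin_subset[OF P])
  have finK: "finite K" using KJ finite_J finite_subset by blast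
  have ov: "override_on p x (J - K) = override_on x p K" if "x \<in> V" for x
    using that p(1) KJ by (auto simp: override_on_def fun_eq_iff PiE_iff extensional_def)
  \<comment> \<open>On \<open>K\<close>, the only blocks on which \<open>P\<close> depends, this
    point agrees with \<open>p\<close>.\<close>
  have Pp: "P (override_on x p K) = P p" if "x \<in> V" for x
    using mlin_override_indep[OF P p(1) that, of "J - K"] finite_J by (simp add: ov[OF that])
  \<comment> \<open>A form in no blocks is constant; it would be zero on the nonempty
    \<open>Z\<close> but nonzero at \<open>p\<close>.\<close>
  have K_ne: "K \<noteq> {}"
  proof
    assume "K = {}"
    obtain x where "x \<in> Z" using Z_ne by blast
    then show False using Pp[of x] mlin_override_indep[OF P, of x p "{}"] PZ[of x] ZV p \<open>K = {}\<close> by auto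
  qed
  have step: "P (x(i := p i)) * Q x = Q (x(i := p i)) * P x"
    if i: "i \<in> K" and Q: "mlin J Q" and QZ: "\<And>x. x \<in> Z \<Longrightarrow> Q x = 0" and x: "x \<in> V" for i Q x
  proof -
    have iJ: "i \<in> J" using i KJ by blast
    interpret H: multilinear_graph scale A J K P i "p i"
    proof
      show "\<exists>x\<in>V. P (x(i := p i)) \<noteq> 0" using p by (intro bexI[of _ p]) auto
    qed (use P i V_mem[OF p(1) iJ] in auto)
    \<comment> \<open>The contraction by \<open>p i\<close> has one block fewer and is nonzero at
      \<open>p\<close>, so by minimality it cannot vanish on \<open>Z\<close>.\<close>
    have aZ: "\<not> (\<forall>x\<in>Z. H.a x = 0)"
    proof
      assume "\<forall>x\<in>Z. H.a x = 0"
      then have "\<P> (K - {i}) H.a"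
        unfolding \<P>_def H.a_def[abs_def]
        using mlin_contract[OF P i V_mem[OF p(1) iJ]] p by (auto intro!: bexI[of _ p])
      from min[OF this] show False using card_Diff1_less[OF finK i] by simp
    qed
    \<comment> \<open>\<open>Z\<close> is irreducible and its points with
      \<open>a \<noteq> 0\<close> lie in \<open>G\<close>, so a polynomial vanishing on
      \<open>G\<close> vanishes on \<open>Z\<close>. Since only \<open>V\<close> lies irreducibly
      above \<open>Z\<close>, and the closure is proper, equality follows.\<close>
    have "Z \<subseteq> zclosure H.G"
    proof
      fix x assume x: "x \<in> Z"
      have "f x = 0" if f: "pol f" "\<And>y. y \<in> H.G \<Longrightarrow> f y = 0" for f
      proof -
        have "H.a y * f y = 0" if "y \<in> Z" for y
          using f(2)[of y] that PZ[OF that] ZV by (auto simp: H.G_def)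
        then show ?thesis using prime[OF H.pol_a f(1)] aZ x by blast
      qed
      then show "x \<in> zclosure H.G" using x ZV by (auto simp: zclosure_def)
    qed
    then have "Z = zclosure H.G"
      using max[OF H.zclosure_G_irreducible] H.zclosure_G_proper by blast
    then have "H.G \<subseteq> Z" using zclosure_superset[OF H.G_V] by blast
    then show ?thesis using QZ by (intro H.cross_mult[OF Q iJ _ x]) auto
  qed
  \<comment> \<open>Replace the blocks in \<open>S\<close> by those of \<open>p\<close> one after
    another, applying \<open>step\<close> each time.\<close>
  have chain: "P (override_on x p S) * Q x = Q (override_on x p S) * P x"
    if S: "finite S" "S \<subseteq> K" and Q: "mlin J Q" "\<And>x. x \<in> Z \<Longrightarrow> Q x = 0" and x: "x \<in> V" for S Q x
    using S x
  proof (induction arbitrary: x rule: finite_induct)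
    case (insert i S)
    let ?o = "\<lambda>x. override_on x p S"
    let ?o' = "\<lambda>x. override_on x p (insert i S)"
    \<comment> \<open>Combining both identities leaves an extra factor \<open>P (?o x)\<close>. As a
      polynomial in \<open>x\<close> it is nonzero, with value \<open>P p\<close> at
      \<open>p\<close>, so it can be cancelled on the irreducible \<open>V\<close>.\<close>
    have "P (?o x) * (P (?o' x) * Q x - Q (?o' x) * P x) = 0" if "x \<in> V" for x
    proof -
      have 1: "P (?o x) * Q x = Q (?o x) * P x" using insert that by blast
      have 2: "P (?o' x) * Q (?o x) = Q (?o' x) * P (?o x)"
        unfolding override_insert using insert.prems Q V_override[OF that p(1)] by (intro step) auto
      have "P (?o x) * (P (?o' x) * Q x) = P (?o' x) * (Q (?o x) * P x)"
        using 1 by (simp add: algebra_simps)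
      also have "\<dots> = (Q (?o' x) * P (?o x)) * P x" using 2 by (simp add: algebra_simps)
      finally show ?thesis by (simp add: algebra_simps)
    qed
    moreover have "P (?o p) \<noteq> 0" using p by (simp add: override_on_def)
    ultimately have "P (?o' x) * Q x - Q (?o' x) * P x = 0"
      by (intro pol_vanish[of "\<lambda>x. P (?o x)" "\<lambda>x. P (?o' x) * Q x - Q (?o' x) * P x" p]
          pol_diff pol_mult pol_override mlin_pol[OF P] mlin_pol[OF Q(1)] p insert.prems)
    then show ?case by simp
  qed simp
  define L where "L = insert n J - K"
  have nK: "n \<notin> K" using n KJ by blast
  define T1 where "T1 = (\<lambda>x\<in>dual_prod scale A K. P (override_on p x K))"
  define T2 where "T2 = (\<lambda>x\<in>dual_prod scale A L. T (override_on x p K) / P p)"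
  have ovK: "override_on p x K \<in> V" if "x \<in> dual_prod scale A K" for x
    using that p(1) KJ by (auto simp: override_on_def PiE_iff extensional_def)
  have ovL: "override_on x p K \<in> dual_prod scale A (insert n J)" if "x \<in> dual_prod scale A L" for x
    using that p(1) KJ by (auto simp: override_on_def PiE_iff extensional_def L_def)
  have T1_T: "T1 \<in> tensors scale A K"
  proof (rule tensorsI)
    show "T1 \<in> extensional (dual_prod scale A K)" by (simp add: T1_def)
    fix x i u assume x: "x \<in> dual_prod scale A K" and i: "i \<in> K" and u: "u \<in> D i"
    have upd: "T1 (x(i := v)) = P ((override_on p x K)(i := v))" if "v \<in> D i" for v
    proof -
      have "override_on p (x(i := v)) K = (override_on p x K)(i := v)"
        using i by (auto simp: override_on_def)
      then show ?thesis using dual_prod_update[OF x i that] by (simp add: T1_def)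
    qed
    show "T1 (x(i := (\<lambda>a. u a + v a))) = T1 (x(i := u)) + T1 (x(i := v))" if "v \<in> D i" for v
      using mlin_add[OF P ovK[OF x] i u that] upd u that dual_add[OF u that] by simp
    show "T1 (x(i := (\<lambda>a. c * u a))) = c * T1 (x(i := u))" for c
      using mlin_scale[OF P ovK[OF x] i u] upd u dual_scale[OF u] by simp
  qed
  have T2_T: "T2 \<in> tensors scale A L"
  proof (rule tensorsI)
    show "T2 \<in> extensional (dual_prod scale A L)" by (simp add: T2_def)
    fix x i u assume x: "x \<in> dual_prod scale A L" and i: "i \<in> L" and u: "u \<in> D i"
    have i': "i \<in> insert n J" using i by (simp add: L_def)
    have upd: "T2 (x(i := v)) = T ((override_on x p K)(i := v)) / P p" if "v \<in> D i" for v
    proof -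
      have "override_on (x(i := v)) p K = (override_on x p K)(i := v)"
        using i by (auto simp: override_on_def L_def)
      then show ?thesis using dual_prod_update[OF x i that] by (simp add: T2_def)
    qed
    show "T2 (x(i := (\<lambda>a. u a + v a))) = T2 (x(i := u)) + T2 (x(i := v))" if "v \<in> D i" for v
      using tensors_add[OF T ovL[OF x] i' u that] upd u that dual_add[OF u that]
      by (simp add: add_divide_distrib)
    show "T2 (x(i := (\<lambda>a. c * u a))) = c * T2 (x(i := u))" for c
      using tensors_scale[OF T ovL[OF x] i' u] upd u dual_scale[OF u] by simp
  qed
  have KL: "K \<union> L = insert n J" using KJ by (auto simp: L_def)
  have factor: "T x = T1 (restrict x K) * T2 (restrict x L)"
    if x: "x \<in> dual_prod scale A (insert n J)" for x
  proof -
    let ?x = "restrict x J"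
    have x': "?x \<in> V" and y: "x n \<in> D n" using x by auto
    have xn: "?x(n := x n) = x" using x by (auto simp: fun_eq_iff PiE_iff extensional_def)
    \<comment> \<open>This is \<open>chain\<close> with \<open>S = K\<close> for the slice at
      \<open>y = x n\<close>; its first factor is the constant \<open>P p\<close>.\<close>
    have "P (override_on ?x p K) * T (?x(n := x n)) = T ((override_on ?x p K)(n := x n)) * P ?x"
      using chain[OF finK order_refl tensor_slice_mlin[OF T n y] ZY[OF _ y] x'] by simp
    moreover have "(override_on ?x p K)(n := x n) = override_on (restrict x L) p K"
      using x nK by (auto simp: fun_eq_iff PiE_iff extensional_def override_on_def L_def)
    ultimately have "P p * T x = T (override_on (restrict x L) p K) * P ?x"
      by (simp add: Pp[OF x'] xn)
    moreover have "restrict x L \<in> dual_prod scale A L" using x by (auto simp: L_def)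
    ultimately have "T x = T2 (restrict x L) * P ?x"
      using p(2) by (simp add: T2_def field_simps)
    moreover have "T1 (restrict x K) = P ?x"
    proof -
      have xK: "restrict x K \<in> dual_prod scale A K" using x KJ by auto
      have "override_on ?x p (J - K) = override_on p (restrict x K) K"
        using p(1) KJ by (auto simp: fun_eq_iff override_on_def PiE_iff extensional_def)
      then show ?thesis
        using mlin_override_indep[OF P x' p(1), of "J - K"] finite_J xK by (simp add: T1_def)
    qed
    ultimately show ?thesis by simp
  qed
  have w0: "x0(n := y0) \<in> dual_prod scale A (insert n J)" using xy0(1,2) by (rule V_extend)
  have nz: "T1 (restrict (x0(n := y0)) K) \<noteq> 0" "T2 (restrict (x0(n := y0)) L) \<noteq> 0"
    using factor[OF w0] xy0(3) by auto
  have "restrict (x0(n := y0)) K \<in> dual_prod scale A K" "restrict (x0(n := y0)) L \<in> dual_prod scale A L"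
    using w0 KL by (auto simp del: fun_upd_apply)
  then have "T1 \<noteq> zero_tensor scale A K" "T2 \<noteq> zero_tensor scale A L"
    using nz by (auto simp: zero_tensor_def)
  moreover have "T = tensor_mult scale A K L T1 T2"
  proof
    fix x show "T x = tensor_mult scale A K L T1 T2 x"
      using factor[of x] T by (cases "x \<in> dual_prod scale A (insert n J)")
        (auto simp: tensor_mult_def KL tensors_def extensional_def)
  qed
  ultimately show ?thesis
    using that[OF KJ K_ne T1_T _ T2_T[unfolded L_def]] by (simp add: L_def)
qed

end

theorem proposition22:
  fixes scale :: "complex \<Rightarrow> 'a::ab_group_add \<Rightarrow> 'a"
    and A :: "nat \<Rightarrow> 'a set"
    and n :: nat
    and T :: "(nat \<Rightarrow> 'a \<Rightarrow> complex) \<Rightarrow> complex"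
  assumes "vector_space scale"
    and "n \<ge> 3"
    and "\<And>i. i \<in> {1..n} \<Longrightarrow> fin_dim_subspace scale (A i)"
    and "T \<in> tensors scale A {1..n}"
  shows "geometric_rank scale A n T = 1 \<longleftrightarrow> partition_rank_one scale A n T"
proof -
  interpret vector_space scale by (rule assms(1))
  interpret dual_product scale A "{1..<n}"
    by unfold_locales (use assms(3) in auto)
  have ins: "insert n {1..<n} = {1..n}" using assms(2) by auto
  have n: "n \<notin> {1..<n}" by simp
  show ?thesis
  proof
    assume "geometric_rank scale A n T = 1"
    then obtain K T1 T2 where K: "K \<subseteq> {1..<n}" "K \<noteq> {}"
      and TT: "T1 \<in> tensors scale A K" "T1 \<noteq> zero_tensor scale A K"
        "T2 \<in> tensors scale A ({1..n} - K)" "T2 \<noteq> zero_tensor scale A ({1..n} - K)"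
        "T = tensor_mult scale A K ({1..n} - K) T1 T2"
      unfolding geometric_rank_def
      by (rule factorization_of_codim_1[OF n, of T, unfolded ins, OF assms(4)]) (rule that)
    have "n \<in> {1..n} - K" using K(1) assms(2) by auto
    then have "{1..n} - K \<noteq> {}" by auto
    moreover have "K \<subseteq> {1..n}" using K(1) by auto
    then have "K \<union> ({1..n} - K) = {1..n}" by (rule Diff_partition)
    ultimately show "partition_rank_one scale A n T"
      unfolding partition_rank_one_def
      by (intro exI[of _ K] exI[of _ "{1..n} - K"] exI[of _ T1] exI[of _ T2] conjI Diff_disjoint K(2) TT)
  next
    assume "partition_rank_one scale A n T"
    then obtain I J T1 T2 where IJ: "I \<union> J = {1..n}" "I \<inter> J = {}" "I \<noteq> {}" "J \<noteq> {}"
      and T1: "T1 \<in> tensors scale A I" "T1 \<noteq> zero_tensor scale A I"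
      and T2: "T2 \<in> tensors scale A J" "T2 \<noteq> zero_tensor scale A J"
      and T: "T = tensor_mult scale A I J T1 T2"
      unfolding partition_rank_one_def by (elim exE conjE) (rule that)
    \<comment> \<open>Block \<open>n\<close> belongs to exactly one factor, and the other factor
      cuts out the hypersurface; commutativity of the product reduces the second case to the
      first.\<close>
    have "n \<in> I \<union> J" unfolding IJ(1) using assms(2) by simp
    then show "geometric_rank scale A n T = 1"
    proof (rule UnE)
      assume "n \<in> J"
      then show ?thesis
        unfolding geometric_rank_def
        using codim_1_of_factorization[OF n _ _ IJ(2,3) T1 T2 T] IJ(1) ins by simp
    next
      assume "n \<in> I"
      have "J \<inter> I = {}" "J \<union> I = {1..n}" using IJ by auto
      moreover have "T = tensor_mult scale A J I T2 T1"
        unfolding T tensor_mult_def by (simp add: Un_commute mult.commute)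
      ultimately show ?thesis
        unfolding geometric_rank_def
        using codim_1_of_factorization[OF n \<open>n \<in> I\<close> _ _ IJ(4) T2 T1] ins by simp
    qed
  qed
qed

end
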